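(* Let $\mathbb{K}$ be a field, let $n\ge 1$, and let $H$ be a Hopf algebra over $\mathbb{K}$ coacting on the diagonal algebra $\mathbb{K}^n$, with coaction $\beta:\mathbb{K}^n\to\mathbb{K}^n\otimes H$. Assume that at least one of the following conditions holds: (1) the linear map $\psi:\mathbb{K}^n\to\mathbb{K}$, $\psi(e_i)=1$ for all $i$, is $H$-colinear (where $\mathbb{K}$ is the trivial $H$-comodule); (2) $S^2=\mathrm{id}_H$, where $S$ is the antipode of $H$; (3) $\mathbb{K}$ has characteristic zero or characteristic $p>n$, and $H$ is cosemisimple. Then there exists a unique Hopf algebra map $f:A_s(n,\mathbb{K})\to H$ such that $(\mathrm{id}_{\mathbb{K}^n}\otimes f)\circ\alpha=\beta$, where $\alpha:\mathbb{K}^n\to\mathbb{K}^n\otimes A_s(n,\mathbb{K})$ is the canonical coaction $\alpha(e_i)=\sum_{k=1}^n e_k\otimes u_{ki}$.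
   Context: $\mathbb{K}^n$ is the diagonal algebra with canonical basis $e_1,\dots,e_n$, $e_ie_j=\delta_{ij}e_i$, $1=\sum_i e_i$. A coaction of a Hopf algebra $H$ on an algebra $A$ is a unital algebra map $\beta:A\to A\otimes H$ that makes $A$ a right $H$-comodule. A Hopf algebra is cosemisimple if its category of comodules is semisimple; equivalently, it has a linear map $h:H\to\mathbb{K}$ (Haar measure) with $h(1)=1$ and $(\mathrm{id}\otimes h)\Delta=h(-)1_H=(h\otimes\mathrm{id})\Delta$. $A_s(n,\mathbb{K})$ is the $\mathbb{K}$-algebra presented by generators $u_{ij}$, $1\le i,j\le n$, and relations, for all $i,j,k$: $u_{ki}u_{kj}=\delta_{ij}u_{ki}$, $\sum_{l=1}^n u_{il}=1$, $u_{ik}u_{jk}=\delta_{ij}u_{ik}$, $\sum_{l=1}^n u_{li}=1$. It is a Hopf algebra with $\Delta(u_{ij})=\sum_k u_{ik}\otimes u_{kj}$, $\varepsilon(u_{ij})=\delta_{ij}$, $S(u_{ij})=u_{ji}$, and $\alpha(e_i)=\sum_k e_k\otimes u_{ki}$ defines a coaction of it on the algebra $\mathbb{K}^n$. *)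

theory Defs
  imports
    "HOL-Analysis.Cartesian_Space"
    "HOL-Library.Poly_Mapping"
begin

section \<open>Multilinear maps and tensor products over a field\<close>

definition bilinear_map ::
    "('k::field \<Rightarrow> 'a::ab_group_add \<Rightarrow> 'a) \<Rightarrow> ('k \<Rightarrow> 'b::ab_group_add \<Rightarrow> 'b) \<Rightarrow>
     ('k \<Rightarrow> 'v::ab_group_add \<Rightarrow> 'v) \<Rightarrow> ('a \<Rightarrow> 'b \<Rightarrow> 'v) \<Rightarrow> bool"
  where "bilinear_map sA sB sV \<phi> \<longleftrightarrow>
    (\<forall>b. Vector_Spaces.linear sA sV (\<lambda>a. \<phi> a b)) \<and>
    (\<forall>a. Vector_Spaces.linear sB sV (\<lambda>b. \<phi> a b))"

definition trilinear_map ::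
    "('k::field \<Rightarrow> 'a::ab_group_add \<Rightarrow> 'a) \<Rightarrow> ('k \<Rightarrow> 'b::ab_group_add \<Rightarrow> 'b) \<Rightarrow>
     ('k \<Rightarrow> 'c::ab_group_add \<Rightarrow> 'c) \<Rightarrow> ('k \<Rightarrow> 'v::ab_group_add \<Rightarrow> 'v) \<Rightarrow>
     ('a \<Rightarrow> 'b \<Rightarrow> 'c \<Rightarrow> 'v) \<Rightarrow> bool"
  where "trilinear_map sA sB sC sV \<phi> \<longleftrightarrow>
    (\<forall>b c. Vector_Spaces.linear sA sV (\<lambda>a. \<phi> a b c)) \<and>
    (\<forall>a c. Vector_Spaces.linear sB sV (\<lambda>b. \<phi> a b c)) \<and>
    (\<forall>a b. Vector_Spaces.linear sC sV (\<lambda>c. \<phi> a b c))"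

text \<open>
  The tensor product depends on the scalar multiplications, hence is a set of elements of a
  fixed type rather than a type of its own. Over a field, \<open>A \<otimes> B\<close> embeds into the dual of the
  space of bilinear forms on \<open>A \<times> B\<close>, and we take this image as the model: \<open>a \<otimes> b\<close> is
  evaluation at \<open>(a, b)\<close>, and the value at functions which are not bilinear forms is set
  to \<open>0\<close>. The type below is only the ambient space; \<open>A \<otimes> B\<close> is \<open>tensor_space\<close>. The universal property, which determines \<open>A \<otimes> B\<close> up to a unique isomorphism, is
  proved in \<open>tensor_universal_property\<close> below.
\<close>

typedef ('k, 'x) functional = "UNIV :: ('x \<Rightarrow> 'k) set"
  morphisms app Functional by simp

setup_lifting type_definition_functional

instantiation functional :: (ab_group_add, type) ab_group_add
begin

lift_definition zero_functional :: "('a, 'b) functional" is "\<lambda>_. 0" .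
lift_definition plus_functional :: "('a, 'b) functional \<Rightarrow> ('a, 'b) functional \<Rightarrow> ('a, 'b) functional"
  is "\<lambda>s t x. s x + t x" .
lift_definition minus_functional :: "('a, 'b) functional \<Rightarrow> ('a, 'b) functional \<Rightarrow> ('a, 'b) functional"
  is "\<lambda>s t x. s x - t x" .
lift_definition uminus_functional :: "('a, 'b) functional \<Rightarrow> ('a, 'b) functional"
  is "\<lambda>s x. - s x" .

instance by standard (transfer; simp add: fun_eq_iff algebra_simps)+

end

type_synonym ('k, 'a, 'b) tensor = "('k, 'a \<Rightarrow> 'b \<Rightarrow> 'k) functional"
type_synonym ('k, 'a, 'b, 'c) tensor3 = "('k, 'a \<Rightarrow> 'b \<Rightarrow> 'c \<Rightarrow> 'k) functional"

lift_definition tensor_scale :: "'k::field \<Rightarrow> ('k, 'x) functional \<Rightarrow> ('k, 'x) functional"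
  is "\<lambda>c t \<beta>. c * t \<beta>" .

lemma functional_eqI: "(\<And>\<beta>. app s \<beta> = app t \<beta>) \<Longrightarrow> s = t"
  by transfer auto

lemma app_simps [simp]:
  "app 0 \<beta> = 0" "app (s + t) \<beta> = app s \<beta> + app t \<beta>"
  "app (s - t) \<beta> = app s \<beta> - app t \<beta>" "app (- s) \<beta> = - app s \<beta>"
  "app (Functional F) \<beta> = F \<beta>"
  by (transfer; simp add: Functional_inverse)+

lemma app_tensor_scale [simp]: "app (tensor_scale c t) \<beta> = c * app t \<beta>"
  by transfer simp

definition pure_tensor ::
    "('k::field \<Rightarrow> 'a::ab_group_add \<Rightarrow> 'a) \<Rightarrow> ('k \<Rightarrow> 'b::ab_group_add \<Rightarrow> 'b) \<Rightarrow>
     'a \<Rightarrow> 'b \<Rightarrow> ('k, 'a, 'b) tensor"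
  where "pure_tensor sA sB a b =
    Functional (\<lambda>\<beta>. if bilinear_map sA sB (*) \<beta> then \<beta> a b else 0)"

definition pure_tensor3 ::
    "('k::field \<Rightarrow> 'a::ab_group_add \<Rightarrow> 'a) \<Rightarrow> ('k \<Rightarrow> 'b::ab_group_add \<Rightarrow> 'b) \<Rightarrow>
     ('k \<Rightarrow> 'c::ab_group_add \<Rightarrow> 'c) \<Rightarrow> 'a \<Rightarrow> 'b \<Rightarrow> 'c \<Rightarrow> ('k, 'a, 'b, 'c) tensor3"
  where "pure_tensor3 sA sB sC a b c =
    Functional (\<lambda>\<beta>. if trilinear_map sA sB sC (*) \<beta> then \<beta> a b c else 0)"

definition tensor_space ::
    "('k::field \<Rightarrow> 'a::ab_group_add \<Rightarrow> 'a) \<Rightarrow> ('k \<Rightarrow> 'b::ab_group_add \<Rightarrow> 'b) \<Rightarrow>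
     ('k, 'a, 'b) tensor set"
  where "tensor_space sA sB = {t. \<exists>xs. t = (\<Sum>(a, b)\<leftarrow>xs. pure_tensor sA sB a b)}"

text \<open>The linear map on \<open>A \<otimes> B\<close> induced by a bilinear map \<open>\<phi>\<close>.\<close>

definition tensor_lift ::
    "('k::field \<Rightarrow> 'a::ab_group_add \<Rightarrow> 'a) \<Rightarrow> ('k \<Rightarrow> 'b::ab_group_add \<Rightarrow> 'b) \<Rightarrow>
     ('a \<Rightarrow> 'b \<Rightarrow> 'v::ab_group_add) \<Rightarrow> ('k, 'a, 'b) tensor \<Rightarrow> 'v"
  where "tensor_lift sA sB \<phi> t =
    (THE v. \<exists>xs. t = (\<Sum>(a, b)\<leftarrow>xs. pure_tensor sA sB a b) \<and> v = (\<Sum>(a, b)\<leftarrow>xs. \<phi> a b))"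

lemma vector_space_field: "vector_space ((*) :: 'k::field \<Rightarrow> 'k \<Rightarrow> 'k)"
  by unfold_locales (auto simp: algebra_simps)

lemma vector_space_tensor_scale: "vector_space tensor_scale"
  by unfold_locales (auto intro!: functional_eqI simp: algebra_simps)

lemma linear_apply_sum_list:
  assumes "Vector_Spaces.linear sV sW f"
  shows "f (\<Sum>x\<leftarrow>xs. g x) = (\<Sum>x\<leftarrow>xs. f (g x))"
proof -
  interpret Vector_Spaces.linear sV sW f by fact
  show ?thesis by (induction xs) (auto simp: zero add)
qed

lemma separating_functional:
  assumes "vector_space sV" "v \<noteq> 0"
  shows "\<exists>g. Vector_Spaces.linear sV ((*) :: 'k::field \<Rightarrow> 'k \<Rightarrow> 'k) g \<and> g v \<noteq> 0"
proof -
  interpret vector_space sV by fact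
  interpret P: vector_space_pair sV "(*) :: 'k \<Rightarrow> 'k \<Rightarrow> 'k"
    by (intro vector_space_pair.intro assms vector_space_field)
  have "independent {v}" using assms by simp
  from P.linear_independent_extend[OF this, of "\<lambda>_. 1"] show ?thesis by fastforce
qed

lemma app_sum_list: "app (\<Sum>x\<leftarrow>xs. f x) \<beta> = (\<Sum>x\<leftarrow>xs. app (f x) \<beta>)"
  by (induction xs) auto

lemma app_sum: "app (\<Sum>x\<in>A. f x) \<beta> = (\<Sum>x\<in>A. app (f x) \<beta>)"
  by (induction A rule: infinite_finite_induct) auto

lemma bilinear_map_compose:
  assumes "bilinear_map sA sB sV \<phi>" "Vector_Spaces.linear sV sW g"
  shows "bilinear_map sA sB sW (\<lambda>a b. g (\<phi> a b))"
  using assms unfolding bilinear_map_def Vector_Spaces.linear_iff by auto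

lemma sum_list_pure_tensor_apply:
  assumes "bilinear_map sA sB (*) \<beta>"
  shows "app (\<Sum>(a, b)\<leftarrow>xs. pure_tensor sA sB a b) \<beta> = (\<Sum>(a, b)\<leftarrow>xs. \<beta> a b)"
  using assms by (induction xs) (auto simp: pure_tensor_def)

lemma tensor_lift_well_defined:
  fixes sV :: "'k::field \<Rightarrow> 'v::ab_group_add \<Rightarrow> 'v"
  assumes \<phi>: "bilinear_map sA sB sV \<phi>"
    and eq: "(\<Sum>(a, b)\<leftarrow>xs. pure_tensor sA sB a b) = (\<Sum>(a, b)\<leftarrow>ys. pure_tensor sA sB a b)"
  shows "(\<Sum>(a, b)\<leftarrow>xs. \<phi> a b) = (\<Sum>(a, b)\<leftarrow>ys. \<phi> a b)"
proof (rule ccontr)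
  assume "\<not> ?thesis"
  hence ne: "(\<Sum>(a, b)\<leftarrow>xs. \<phi> a b) - (\<Sum>(a, b)\<leftarrow>ys. \<phi> a b) \<noteq> 0" by simp
  have vs: "vector_space sV"
    using \<phi> by (auto simp: bilinear_map_def Vector_Spaces.linear_iff)
  obtain g where g: "Vector_Spaces.linear sV (*) g"
    and gne: "g ((\<Sum>(a, b)\<leftarrow>xs. \<phi> a b) - (\<Sum>(a, b)\<leftarrow>ys. \<phi> a b)) \<noteq> 0"
    using separating_functional[OF vs ne] by auto
  interpret Vector_Spaces.linear sV "(*)" g by fact
  have b: "bilinear_map sA sB (*) (\<lambda>a b. g (\<phi> a b))"
    using bilinear_map_compose[OF \<phi> g] .
  have *: "g (\<Sum>(a, b)\<leftarrow>zs. \<phi> a b) = app (\<Sum>(a, b)\<leftarrow>zs. pure_tensor sA sB a b) (\<lambda>a b. g (\<phi> a b))" for zs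
    unfolding sum_list_pure_tensor_apply[OF b] linear_apply_sum_list[OF g]
    by (simp add: case_prod_unfold)
  show False using gne * eq by (simp add: diff)
qed

lemma tensor_lift_sum_list:
  assumes "bilinear_map sA sB sV \<phi>"
  shows "tensor_lift sA sB \<phi> (\<Sum>(a, b)\<leftarrow>xs. pure_tensor sA sB a b) = (\<Sum>(a, b)\<leftarrow>xs. \<phi> a b)"
  unfolding tensor_lift_def
proof (rule the_equality)
  fix v assume "\<exists>ys. (\<Sum>(a, b)\<leftarrow>xs. pure_tensor sA sB a b) = (\<Sum>(a, b)\<leftarrow>ys. pure_tensor sA sB a b) \<and>
    v = (\<Sum>(a, b)\<leftarrow>ys. \<phi> a b)"
  thus "v = (\<Sum>(a, b)\<leftarrow>xs. \<phi> a b)"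
    using tensor_lift_well_defined[OF assms, of xs] by metis
qed blast

lemma tensor_space_0 [simp]: "0 \<in> tensor_space sA sB"
  unfolding tensor_space_def by (auto intro!: exI[of _ "[]"])

lemma tensor_space_pure [simp]: "pure_tensor sA sB a b \<in> tensor_space sA sB"
  unfolding tensor_space_def by (auto intro!: exI[of _ "[(a, b)]"])

lemma tensor_space_add:
  assumes "s \<in> tensor_space sA sB" "t \<in> tensor_space sA sB"
  shows "s + t \<in> tensor_space sA sB"
proof -
  from assms obtain xs ys where "s = (\<Sum>(a, b)\<leftarrow>xs. pure_tensor sA sB a b)"
    "t = (\<Sum>(a, b)\<leftarrow>ys. pure_tensor sA sB a b)"
    unfolding tensor_space_def by blast
  hence "s + t = (\<Sum>(a, b)\<leftarrow>xs @ ys. pure_tensor sA sB a b)" by simp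
  thus ?thesis unfolding tensor_space_def by blast
qed

lemma tensor_space_sum:
  "(\<And>x. x \<in> I \<Longrightarrow> f x \<in> tensor_space sA sB) \<Longrightarrow> (\<Sum>x\<in>I. f x) \<in> tensor_space sA sB"
  by (induction I rule: infinite_finite_induct) (auto intro: tensor_space_add)

lemma tensor_space_sum_list:
  "(\<And>x. x \<in> set xs \<Longrightarrow> f x \<in> tensor_space sA sB) \<Longrightarrow> (\<Sum>x\<leftarrow>xs. f x) \<in> tensor_space sA sB"
  by (induction xs) (auto intro: tensor_space_add)

lemma bilinear_pure_tensor:
  assumes "vector_space sA" "vector_space sB"
  shows "bilinear_map sA sB tensor_scale (pure_tensor sA sB)"
  using assms vector_space_tensor_scale
  unfolding bilinear_map_def Vector_Spaces.linear_iff
  by (auto intro!: functional_eqI simp: pure_tensor_def bilinear_map_def Vector_Spaces.linear_iff)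

lemma trilinear_pure_tensor3:
  assumes "vector_space sA" "vector_space sB" "vector_space sC"
  shows "trilinear_map sA sB sC tensor_scale (pure_tensor3 sA sB sC)"
  using assms vector_space_tensor_scale
  unfolding trilinear_map_def Vector_Spaces.linear_iff
  by (auto intro!: functional_eqI simp: pure_tensor3_def trilinear_map_def Vector_Spaces.linear_iff)

lemma tensor_space_scale:
  assumes "vector_space sA" "vector_space sB" "t \<in> tensor_space sA sB"
  shows "tensor_scale c t \<in> tensor_space sA sB"
proof -
  from assms obtain xs where t: "t = (\<Sum>(a, b)\<leftarrow>xs. pure_tensor sA sB a b)"
    unfolding tensor_space_def by blast
  have sc: "tensor_scale c (pure_tensor sA sB a b) = pure_tensor sA sB (sA c a) b" for a b
    using bilinear_pure_tensor[OF assms(1,2)] by (auto simp: bilinear_map_def Vector_Spaces.linear_iff)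
  have l: "Vector_Spaces.linear tensor_scale tensor_scale (tensor_scale c)"
    using vector_space_tensor_scale
    by (auto intro!: functional_eqI simp: Vector_Spaces.linear_iff algebra_simps)
  show ?thesis
    unfolding t linear_apply_sum_list[OF l] case_prod_unfold sc
    by (rule tensor_space_sum_list) simp
qed

lemma tensor_space_induct [consumes 1, case_names zero add]:
  assumes "t \<in> tensor_space sA sB" "P 0"
    and "\<And>a b t. t \<in> tensor_space sA sB \<Longrightarrow> P t \<Longrightarrow> P (pure_tensor sA sB a b + t)"
  shows "P t"
proof -
  from assms(1) obtain xs where t: "t = (\<Sum>(a, b)\<leftarrow>xs. pure_tensor sA sB a b)"
    unfolding tensor_space_def by blast
  show ?thesis unfolding t
    by (induction xs) (auto intro!: assms(2,3) tensor_space_sum_list)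
qed

context
  fixes sA :: "'k::field \<Rightarrow> 'a::ab_group_add \<Rightarrow> 'a" and sB :: "'k \<Rightarrow> 'b::ab_group_add \<Rightarrow> 'b"
    and sV :: "'k \<Rightarrow> 'v::ab_group_add \<Rightarrow> 'v" and \<phi>
  assumes \<phi>: "bilinear_map sA sB sV \<phi>"
begin

lemma tensor_lift_0: "tensor_lift sA sB \<phi> 0 = 0"
  using tensor_lift_sum_list[OF \<phi>, of "[]"] by simp

lemma tensor_lift_pure: "tensor_lift sA sB \<phi> (pure_tensor sA sB a b) = \<phi> a b"
  using tensor_lift_sum_list[OF \<phi>, of "[(a, b)]"] by simp

lemma tensor_lift_add:
  assumes "s \<in> tensor_space sA sB" "t \<in> tensor_space sA sB"
  shows "tensor_lift sA sB \<phi> (s + t) = tensor_lift sA sB \<phi> s + tensor_lift sA sB \<phi> t"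
proof -
  from assms obtain xs ys where eq: "s = (\<Sum>(a, b)\<leftarrow>xs. pure_tensor sA sB a b)"
    "t = (\<Sum>(a, b)\<leftarrow>ys. pure_tensor sA sB a b)"
    unfolding tensor_space_def by blast
  have "s + t = (\<Sum>(a, b)\<leftarrow>xs @ ys. pure_tensor sA sB a b)" by (simp add: eq)
  thus ?thesis by (simp only: eq tensor_lift_sum_list[OF \<phi>]) simp
qed

lemma tensor_lift_sum:
  "(\<And>x. x \<in> I \<Longrightarrow> f x \<in> tensor_space sA sB) \<Longrightarrow>
   tensor_lift sA sB \<phi> (\<Sum>x\<in>I. f x) = (\<Sum>x\<in>I. tensor_lift sA sB \<phi> (f x))"
  by (induction I rule: infinite_finite_induct)
     (auto simp: tensor_lift_0 tensor_lift_add tensor_space_sum)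

lemma tensor_lift_scale:
  assumes "t \<in> tensor_space sA sB"
  shows "tensor_lift sA sB \<phi> (tensor_scale c t) = sV c (tensor_lift sA sB \<phi> t)"
  using assms
proof (induction rule: tensor_space_induct)
  case zero
  interpret vector_space sV using \<phi> by (auto simp: bilinear_map_def Vector_Spaces.linear_iff)
  have "tensor_scale c 0 = (0 :: ('k, 'a, 'b) tensor)" by (auto intro: functional_eqI)
  thus ?case by (simp add: tensor_lift_0)
next
  case (add a b t)
  interpret vector_space sV using \<phi> by (auto simp: bilinear_map_def Vector_Spaces.linear_iff)
  have vs: "vector_space sA" "vector_space sB"
    using \<phi> by (auto simp: bilinear_map_def Vector_Spaces.linear_iff)
  have sc: "tensor_scale c (pure_tensor sA sB a b) = pure_tensor sA sB (sA c a) b"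
    using bilinear_pure_tensor[OF vs] by (auto simp: bilinear_map_def Vector_Spaces.linear_iff)
  have "tensor_scale c (pure_tensor sA sB a b + t) = pure_tensor sA sB (sA c a) b + tensor_scale c t"
    by (simp add: vector_space.vector_space_assms[OF vector_space_tensor_scale] sc)
  thus ?case using \<phi> add tensor_space_scale[OF vs]
    by (simp add: tensor_lift_add tensor_lift_pure scale_right_distrib)
       (simp add: bilinear_map_def Vector_Spaces.linear_iff)
qed

end

theorem tensor_universal_property:
  assumes "bilinear_map sA sB sV \<phi>"
  shows "\<And>s t. s \<in> tensor_space sA sB \<Longrightarrow> t \<in> tensor_space sA sB \<Longrightarrow>
           tensor_lift sA sB \<phi> (s + t) = tensor_lift sA sB \<phi> s + tensor_lift sA sB \<phi> t"
    and "\<And>c t. t \<in> tensor_space sA sB \<Longrightarrow>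
           tensor_lift sA sB \<phi> (tensor_scale c t) = sV c (tensor_lift sA sB \<phi> t)"
    and "\<And>a b. tensor_lift sA sB \<phi> (pure_tensor sA sB a b) = \<phi> a b"
    and "\<And>L t. \<lbrakk>\<And>s t. s \<in> tensor_space sA sB \<Longrightarrow> t \<in> tensor_space sA sB \<Longrightarrow> L (s + t) = L s + L t;
           \<And>a b. L (pure_tensor sA sB a b) = \<phi> a b; t \<in> tensor_space sA sB\<rbrakk> \<Longrightarrow>
           L t = tensor_lift sA sB \<phi> t"
proof -
  fix L t
  assume L: "\<And>s t. s \<in> tensor_space sA sB \<Longrightarrow> t \<in> tensor_space sA sB \<Longrightarrow> L (s + t) = L s + L t"
    and pure: "\<And>a b. L (pure_tensor sA sB a b) = \<phi> a b" and t: "t \<in> tensor_space sA sB"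
  have "L 0 = 0" using L[of 0 0] by simp
  from t show "L t = tensor_lift sA sB \<phi> t"
    by (induction rule: tensor_space_induct)
       (simp_all add: L pure \<open>L 0 = 0\<close> tensor_lift_0[OF assms] tensor_lift_add[OF assms]
          tensor_lift_pure[OF assms])
qed (fact tensor_lift_add[OF assms] tensor_lift_scale[OF assms] tensor_lift_pure[OF assms])+


lemma tensor_lift_add_fun:
  assumes \<phi>: "bilinear_map sA sB sV \<phi>" and \<psi>: "bilinear_map sA sB sV \<psi>"
    and t: "t \<in> tensor_space sA sB"
  shows "bilinear_map sA sB sV (\<lambda>a b. \<phi> a b + \<psi> a b)"
    and "tensor_lift sA sB (\<lambda>a b. \<phi> a b + \<psi> a b) t = tensor_lift sA sB \<phi> t + tensor_lift sA sB \<psi> t"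
proof -
  interpret vector_space sV using \<phi> by (auto simp: bilinear_map_def Vector_Spaces.linear_iff)
  show b: "bilinear_map sA sB sV (\<lambda>a b. \<phi> a b + \<psi> a b)"
    using \<phi> \<psi> unfolding bilinear_map_def Vector_Spaces.linear_iff
    by (auto simp: scale_right_distrib add_ac)
  show "tensor_lift sA sB (\<lambda>a b. \<phi> a b + \<psi> a b) t = tensor_lift sA sB \<phi> t + tensor_lift sA sB \<psi> t"
    using t by (induction rule: tensor_space_induct)
      (simp_all add: tensor_lift_0[OF \<phi>] tensor_lift_0[OF \<psi>] tensor_lift_0[OF b]
        tensor_lift_add[OF \<phi>] tensor_lift_add[OF \<psi>] tensor_lift_add[OF b]
        tensor_lift_pure[OF \<phi>] tensor_lift_pure[OF \<psi>] tensor_lift_pure[OF b])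
qed

lemma linear_tensor_lift:
  assumes \<phi>: "bilinear_map sA sB sV \<phi>" and g: "Vector_Spaces.linear sV sW g"
    and t: "t \<in> tensor_space sA sB"
  shows "g (tensor_lift sA sB \<phi> t) = tensor_lift sA sB (\<lambda>a b. g (\<phi> a b)) t"
proof -
  note b = bilinear_map_compose[OF \<phi> g]
  interpret Vector_Spaces.linear sV sW g by fact
  show ?thesis
    using t by (induction rule: tensor_space_induct)
      (simp_all add: tensor_lift_0[OF \<phi>] tensor_lift_0[OF b] zero add
        tensor_lift_add[OF \<phi>] tensor_lift_add[OF b] tensor_lift_pure[OF \<phi>] tensor_lift_pure[OF b])
qed

lemma app_tensor_lift:
  assumes "bilinear_map sA sB tensor_scale \<phi>" "t \<in> tensor_space sA sB"
  shows "app (tensor_lift sA sB \<phi> t) \<beta> = tensor_lift sA sB (\<lambda>a b. app (\<phi> a b) \<beta>) t"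
proof (rule linear_tensor_lift[OF assms(1) _ assms(2)])
  show "Vector_Spaces.linear tensor_scale (*) (\<lambda>t. app t \<beta>)"
    by (auto simp: Vector_Spaces.linear_iff vector_space_tensor_scale vector_space_field)
qed

lemma linear_tensor_lift_param:
  assumes sC: "vector_space sC" and \<phi>: "\<And>c. bilinear_map sA sB sV (\<phi> c)"
    and l: "\<And>a b. Vector_Spaces.linear sC sV (\<lambda>c. \<phi> c a b)"
    and t: "t \<in> tensor_space sA sB"
  shows "Vector_Spaces.linear sC sV (\<lambda>c. tensor_lift sA sB (\<phi> c) t)"
proof -
  have sV: "vector_space sV" using \<phi> by (auto simp: bilinear_map_def Vector_Spaces.linear_iff)
  have 1: "tensor_lift sA sB (\<phi> (c + d)) t = tensor_lift sA sB (\<phi> c) t + tensor_lift sA sB (\<phi> d) t" for c d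
  proof -
    have "\<phi> (c + d) = (\<lambda>a b. \<phi> c a b + \<phi> d a b)"
      by (intro ext) (use l in \<open>simp add: Vector_Spaces.linear_iff\<close>)
    thus ?thesis using tensor_lift_add_fun(2)[OF \<phi> \<phi> t] by simp
  qed
  have 2: "tensor_lift sA sB (\<phi> (sC r c)) t = sV r (tensor_lift sA sB (\<phi> c) t)" for r c
  proof -
    have "\<phi> (sC r c) = (\<lambda>a b. sV r (\<phi> c a b))"
      by (intro ext) (use l in \<open>simp add: Vector_Spaces.linear_iff\<close>)
    with linear_tensor_lift[OF \<phi> vector_space.linear_scale_self[OF sV] t]
    show ?thesis by simp
  qed
  show ?thesis using 1 2 sC sV by (simp add: Vector_Spaces.linear_iff)
qed

lemma tensor_lift_in_tensor_space:
  assumes "bilinear_map sA sB tensor_scale \<phi>" "t \<in> tensor_space sA sB"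
    and "\<And>a b. \<phi> a b \<in> tensor_space sC sD"
  shows "tensor_lift sA sB \<phi> t \<in> tensor_space sC sD"
  using assms(2) by (induction rule: tensor_space_induct)
    (auto simp: tensor_lift_0[OF assms(1)] tensor_lift_add[OF assms(1)]
      tensor_lift_pure[OF assms(1)] intro: tensor_space_add assms(3))

definition tensor_map ::
    "('k::field \<Rightarrow> 'a::ab_group_add \<Rightarrow> 'a) \<Rightarrow> ('k \<Rightarrow> 'b::ab_group_add \<Rightarrow> 'b) \<Rightarrow>
     ('k \<Rightarrow> 'c::ab_group_add \<Rightarrow> 'c) \<Rightarrow> ('k \<Rightarrow> 'd::ab_group_add \<Rightarrow> 'd) \<Rightarrow>
     ('a \<Rightarrow> 'c) \<Rightarrow> ('b \<Rightarrow> 'd) \<Rightarrow> ('k, 'a, 'b) tensor \<Rightarrow> ('k, 'c, 'd) tensor"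
  where "tensor_map sA sB sC sD f g =
    tensor_lift sA sB (\<lambda>a b. pure_tensor sC sD (f a) (g b))"

text \<open>
  For \<open>F : A \<rightarrow> X \<otimes> Y\<close> and \<open>G : B \<rightarrow> X \<otimes> Y\<close>, the maps \<open>F \<otimes> id : A \<otimes> B \<rightarrow> X \<otimes> Y \<otimes> B\<close> and
  \<open>id \<otimes> G : A \<otimes> B \<rightarrow> A \<otimes> X \<otimes> Y\<close>, where the two bracketings of a triple tensor product are
  identified with the unbracketed one.
\<close>

definition tensor_map_left ::
    "('k::field \<Rightarrow> 'a::ab_group_add \<Rightarrow> 'a) \<Rightarrow> ('k \<Rightarrow> 'b::ab_group_add \<Rightarrow> 'b) \<Rightarrow>
     ('k \<Rightarrow> 'x::ab_group_add \<Rightarrow> 'x) \<Rightarrow> ('k \<Rightarrow> 'y::ab_group_add \<Rightarrow> 'y) \<Rightarrow>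
     ('a \<Rightarrow> ('k, 'x, 'y) tensor) \<Rightarrow> ('k, 'a, 'b) tensor \<Rightarrow> ('k, 'x, 'y, 'b) tensor3"
  where "tensor_map_left sA sB sX sY F =
    tensor_lift sA sB (\<lambda>a b. tensor_lift sX sY (\<lambda>x y. pure_tensor3 sX sY sB x y b) (F a))"

definition tensor_map_right ::
    "('k::field \<Rightarrow> 'a::ab_group_add \<Rightarrow> 'a) \<Rightarrow> ('k \<Rightarrow> 'b::ab_group_add \<Rightarrow> 'b) \<Rightarrow>
     ('k \<Rightarrow> 'x::ab_group_add \<Rightarrow> 'x) \<Rightarrow> ('k \<Rightarrow> 'y::ab_group_add \<Rightarrow> 'y) \<Rightarrow>
     ('b \<Rightarrow> ('k, 'x, 'y) tensor) \<Rightarrow> ('k, 'a, 'b) tensor \<Rightarrow> ('k, 'a, 'x, 'y) tensor3"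
  where "tensor_map_right sA sB sX sY G =
    tensor_lift sA sB (\<lambda>a b. tensor_lift sX sY (\<lambda>x y. pure_tensor3 sA sX sY a x y) (G b))"


section \<open>Algebras, Hopf algebras and coactions\<close>

locale k_algebra = vector_space scale
  for scale :: "'k::field \<Rightarrow> 'a::ring_1 \<Rightarrow> 'a" +
  assumes scale_mult_left: "scale c x * y = scale c (x * y)"
    and scale_mult_right: "x * scale c y = scale c (x * y)"

definition algebra_hom ::
    "('k::field \<Rightarrow> 'a::ring_1 \<Rightarrow> 'a) \<Rightarrow> ('k \<Rightarrow> 'b::ring_1 \<Rightarrow> 'b) \<Rightarrow> ('a \<Rightarrow> 'b) \<Rightarrow> bool"
  where "algebra_hom sA sB f \<longleftrightarrow>
    Vector_Spaces.linear sA sB f \<and> f 1 = 1 \<and> (\<forall>x y. f (x * y) = f x * f y)"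

text \<open>Componentwise multiplication on \<open>A \<otimes> B\<close>.\<close>

definition tensor_mult ::
    "('k::field \<Rightarrow> 'a::ring_1 \<Rightarrow> 'a) \<Rightarrow> ('k \<Rightarrow> 'b::ring_1 \<Rightarrow> 'b) \<Rightarrow>
     ('k, 'a, 'b) tensor \<Rightarrow> ('k, 'a, 'b) tensor \<Rightarrow> ('k, 'a, 'b) tensor"
  where "tensor_mult sA sB s t =
    tensor_lift sA sB (\<lambda>a b. tensor_lift sA sB (\<lambda>a' b'. pure_tensor sA sB (a * a') (b * b')) t) s"

locale hopf_algebra = k_algebra scale
  for scale :: "'k::field \<Rightarrow> 'h::ring_1 \<Rightarrow> 'h" +
  fixes \<Delta> :: "'h \<Rightarrow> ('k, 'h, 'h) tensor" and \<epsilon> :: "'h \<Rightarrow> 'k" and S :: "'h \<Rightarrow> 'h"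
  assumes comult_closed: "\<Delta> x \<in> tensor_space scale scale"
    and comult_linear: "Vector_Spaces.linear scale tensor_scale \<Delta>"
    and comult_one: "\<Delta> 1 = pure_tensor scale scale 1 1"
    and comult_mult: "\<Delta> (x * y) = tensor_mult scale scale (\<Delta> x) (\<Delta> y)"
    and coassoc: "tensor_map_left scale scale scale scale \<Delta> (\<Delta> x) =
                  tensor_map_right scale scale scale scale \<Delta> (\<Delta> x)"
    and counit_hom: "algebra_hom scale (*) \<epsilon>"
    and counit_left: "tensor_lift scale scale (\<lambda>a b. scale (\<epsilon> a) b) (\<Delta> x) = x"
    and counit_right: "tensor_lift scale scale (\<lambda>a b. scale (\<epsilon> b) a) (\<Delta> x) = x"
    and antipode_linear: "Vector_Spaces.linear scale scale S"
    and antipode_left: "tensor_lift scale scale (\<lambda>a b. S a * b) (\<Delta> x) = scale (\<epsilon> x) 1"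
    and antipode_right: "tensor_lift scale scale (\<lambda>a b. a * S b) (\<Delta> x) = scale (\<epsilon> x) 1"

definition hopf_algebra_hom ::
    "('k::field \<Rightarrow> 'g::ring_1 \<Rightarrow> 'g) \<Rightarrow> ('g \<Rightarrow> ('k, 'g, 'g) tensor) \<Rightarrow> ('g \<Rightarrow> 'k) \<Rightarrow> ('g \<Rightarrow> 'g) \<Rightarrow>
     ('k \<Rightarrow> 'h::ring_1 \<Rightarrow> 'h) \<Rightarrow> ('h \<Rightarrow> ('k, 'h, 'h) tensor) \<Rightarrow> ('h \<Rightarrow> 'k) \<Rightarrow> ('h \<Rightarrow> 'h) \<Rightarrow>
     ('g \<Rightarrow> 'h) \<Rightarrow> bool"
  where "hopf_algebra_hom sG \<Delta>G \<epsilon>G SG sH \<Delta>H \<epsilon>H SH f \<longleftrightarrow>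
    algebra_hom sG sH f \<and>
    (\<forall>x. \<Delta>H (f x) = tensor_map sG sG sH sH f f (\<Delta>G x)) \<and>
    (\<forall>x. \<epsilon>H (f x) = \<epsilon>G x) \<and>
    (\<forall>x. SH (f x) = f (SG x))"

definition right_comodule ::
    "('k::field \<Rightarrow> 'v::ab_group_add \<Rightarrow> 'v) \<Rightarrow> ('k \<Rightarrow> 'h::ring_1 \<Rightarrow> 'h) \<Rightarrow>
     ('h \<Rightarrow> ('k, 'h, 'h) tensor) \<Rightarrow> ('h \<Rightarrow> 'k) \<Rightarrow> ('v \<Rightarrow> ('k, 'v, 'h) tensor) \<Rightarrow> bool"
  where "right_comodule sV sH \<Delta> \<epsilon> \<rho> \<longleftrightarrow>
    Vector_Spaces.linear sV tensor_scale \<rho> \<and>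
    (\<forall>v. \<rho> v \<in> tensor_space sV sH) \<and>
    (\<forall>v. tensor_map_left sV sH sV sH \<rho> (\<rho> v) = tensor_map_right sV sH sH sH \<Delta> (\<rho> v)) \<and>
    (\<forall>v. tensor_lift sV sH (\<lambda>w h. sV (\<epsilon> h) w) (\<rho> v) = v)"

definition comodule_hom ::
    "('k::field \<Rightarrow> 'v::ab_group_add \<Rightarrow> 'v) \<Rightarrow> ('k \<Rightarrow> 'w::ab_group_add \<Rightarrow> 'w) \<Rightarrow>
     ('k \<Rightarrow> 'h::ring_1 \<Rightarrow> 'h) \<Rightarrow> ('v \<Rightarrow> ('k, 'v, 'h) tensor) \<Rightarrow> ('w \<Rightarrow> ('k, 'w, 'h) tensor) \<Rightarrow>
     ('v \<Rightarrow> 'w) \<Rightarrow> bool"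
  where "comodule_hom sV sW sH \<rho> \<sigma> f \<longleftrightarrow>
    Vector_Spaces.linear sV sW f \<and>
    (\<forall>v. \<sigma> (f v) = tensor_map sV sH sW sH f id (\<rho> v))"

definition trivial_comodule :: "('k::field \<Rightarrow> 'h::ring_1 \<Rightarrow> 'h) \<Rightarrow> 'k \<Rightarrow> ('k, 'k, 'h) tensor"
  where "trivial_comodule sH c = pure_tensor (*) sH c 1"

definition algebra_coaction ::
    "('k::field \<Rightarrow> 'a::ring_1 \<Rightarrow> 'a) \<Rightarrow> ('k \<Rightarrow> 'h::ring_1 \<Rightarrow> 'h) \<Rightarrow>
     ('h \<Rightarrow> ('k, 'h, 'h) tensor) \<Rightarrow> ('h \<Rightarrow> 'k) \<Rightarrow> ('a \<Rightarrow> ('k, 'a, 'h) tensor) \<Rightarrow> bool"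
  where "algebra_coaction sA sH \<Delta> \<epsilon> \<beta> \<longleftrightarrow>
    right_comodule sA sH \<Delta> \<epsilon> \<beta> \<and>
    \<beta> 1 = pure_tensor sA sH 1 1 \<and>
    (\<forall>x y. \<beta> (x * y) = tensor_mult sA sH (\<beta> x) (\<beta> y))"

text \<open>
  A Hopf algebra has semisimple comodule category iff it has a Haar measure; we use the latter
  as the definition, since HOL cannot quantify over the carrier types of all comodules. The two
  invariance conditions are \<open>(id \<otimes> h) \<circ> \<Delta> = h(-) 1 = (h \<otimes> id) \<circ> \<Delta>\<close> with values in \<open>H\<close>.
\<close>

definition haar_measure ::
    "('k::field \<Rightarrow> 'h::ring_1 \<Rightarrow> 'h) \<Rightarrow> ('h \<Rightarrow> ('k, 'h, 'h) tensor) \<Rightarrow> ('h \<Rightarrow> 'k) \<Rightarrow> bool"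
  where "haar_measure sH \<Delta> h \<longleftrightarrow>
    Vector_Spaces.linear sH (*) h \<and> h 1 = 1 \<and>
    (\<forall>x. tensor_lift sH sH (\<lambda>a b. sH (h b) a) (\<Delta> x) = sH (h x) 1) \<and>
    (\<forall>x. tensor_lift sH sH (\<lambda>a b. sH (h a) b) (\<Delta> x) = sH (h x) 1)"

definition cosemisimple ::
    "('k::field \<Rightarrow> 'h::ring_1 \<Rightarrow> 'h) \<Rightarrow> ('h \<Rightarrow> ('k, 'h, 'h) tensor) \<Rightarrow> bool"
  where "cosemisimple sH \<Delta> \<longleftrightarrow> (\<exists>h. haar_measure sH \<Delta> h)"

lemma k_algebra_field: "k_algebra ((*) :: 'k::field \<Rightarrow> 'k \<Rightarrow> 'k)"
  by unfold_locales (auto simp: algebra_simps)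

lemma k_algebra_vec: "k_algebra ((*s) :: 'k::field \<Rightarrow> 'k ^ 'n \<Rightarrow> 'k ^ 'n)"
  by unfold_locales (auto simp: vec_eq_iff algebra_simps)

context
  fixes sA :: "'k::field \<Rightarrow> 'a::ring_1 \<Rightarrow> 'a" and sB :: "'k \<Rightarrow> 'b::ring_1 \<Rightarrow> 'b"
  assumes kA: "k_algebra sA" and kB: "k_algebra sB"
begin

interpretation A: k_algebra sA by (fact kA)
interpretation B: k_algebra sB by (fact kB)

lemma bilinear_shift:
  assumes "bilinear_map sA sB sV \<phi>"
  shows "bilinear_map sA sB sV (\<lambda>a' b'. \<phi> (a * a') (b * b'))"
    and "bilinear_map sA sB sV (\<lambda>a b. \<phi> (a * a') (b * b'))"
  using assms unfolding bilinear_map_def Vector_Spaces.linear_iff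
  by (auto simp: distrib_left distrib_right A.scale_mult_left A.scale_mult_right
        B.scale_mult_left B.scale_mult_right)

lemma bilinear_lift_shift:
  assumes \<phi>: "bilinear_map sA sB sV \<phi>" and t: "t \<in> tensor_space sA sB"
  shows "bilinear_map sA sB sV (\<lambda>a b. tensor_lift sA sB (\<lambda>a' b'. \<phi> (a * a') (b * b')) t)"
proof -
  have "Vector_Spaces.linear sA sV (\<lambda>a. \<phi> (a * a') (b * b'))"
    "Vector_Spaces.linear sB sV (\<lambda>b. \<phi> (a * a') (b * b'))" for a a' b b'
    using bilinear_shift(2)[OF \<phi>] by (auto simp: bilinear_map_def)
  thus ?thesis
    unfolding bilinear_map_def
    by (auto intro!: linear_tensor_lift_param bilinear_shift(1) \<phi> t
          A.vector_space_axioms B.vector_space_axioms)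
qed

lemma bilinear_pure: "bilinear_map sA sB tensor_scale (pure_tensor sA sB)"
  by (intro bilinear_pure_tensor A.vector_space_axioms B.vector_space_axioms)

lemmas bilinear_mult_pure =
  bilinear_shift(1)[OF bilinear_pure] bilinear_lift_shift[OF bilinear_pure]

lemma tensor_mult_closed:
  assumes "s \<in> tensor_space sA sB" "t \<in> tensor_space sA sB"
  shows "tensor_mult sA sB s t \<in> tensor_space sA sB"
  unfolding tensor_mult_def
  by (intro tensor_lift_in_tensor_space bilinear_mult_pure assms tensor_space_pure)

lemma tensor_mult_pure:
  "tensor_mult sA sB (pure_tensor sA sB a b) (pure_tensor sA sB a' b') =
   pure_tensor sA sB (a * a') (b * b')"
  unfolding tensor_mult_def
  by (simp add: tensor_lift_pure[OF bilinear_mult_pure(2)] tensor_lift_pure[OF bilinear_mult_pure(1)]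
        tensor_lift_pure[OF bilinear_shift(2)[OF bilinear_pure]])

lemma tensor_mult_add_left:
  assumes "s \<in> tensor_space sA sB" "s' \<in> tensor_space sA sB" "t \<in> tensor_space sA sB"
  shows "tensor_mult sA sB (s + s') t = tensor_mult sA sB s t + tensor_mult sA sB s' t"
  unfolding tensor_mult_def using assms by (simp add: tensor_lift_add[OF bilinear_mult_pure(2)])

lemma tensor_mult_add_right:
  assumes "s \<in> tensor_space sA sB" "t \<in> tensor_space sA sB" "t' \<in> tensor_space sA sB"
  shows "tensor_mult sA sB s (t + t') = tensor_mult sA sB s t + tensor_mult sA sB s t'"
  unfolding tensor_mult_def using assms
  by (simp add: tensor_lift_add[OF bilinear_mult_pure(1)] tensor_lift_add_fun(2)[OF bilinear_mult_pure(2) bilinear_mult_pure(2)])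

lemma tensor_mult_scale_left:
  assumes "s \<in> tensor_space sA sB" "t \<in> tensor_space sA sB"
  shows "tensor_mult sA sB (tensor_scale c s) t = tensor_scale c (tensor_mult sA sB s t)"
  unfolding tensor_mult_def using assms by (simp add: tensor_lift_scale[OF bilinear_mult_pure(2)])

lemma tensor_mult_scale_right:
  assumes "s \<in> tensor_space sA sB" "t \<in> tensor_space sA sB"
  shows "tensor_mult sA sB s (tensor_scale c t) = tensor_scale c (tensor_mult sA sB s t)"
  unfolding tensor_mult_def using assms
  by (simp add: tensor_lift_scale[OF bilinear_mult_pure(1)]
        linear_tensor_lift[OF bilinear_mult_pure(2) vector_space.linear_scale_self[OF vector_space_tensor_scale]])

lemma tensor_mult_0_left: "t \<in> tensor_space sA sB \<Longrightarrow> tensor_mult sA sB 0 t = 0"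
  unfolding tensor_mult_def by (simp add: tensor_lift_0[OF bilinear_mult_pure(2)])

lemma tensor_mult_0_right: "s \<in> tensor_space sA sB \<Longrightarrow> tensor_mult sA sB s 0 = 0"
  using tensor_mult_add_right[of s 0 0] by simp

lemma tensor_lift_mult:
  assumes \<phi>: "bilinear_map sA sB sV \<phi>"
    and s: "s \<in> tensor_space sA sB" and t: "t \<in> tensor_space sA sB"
  shows "tensor_lift sA sB \<phi> (tensor_mult sA sB s t) =
    tensor_lift sA sB (\<lambda>a b. tensor_lift sA sB (\<lambda>a' b'. \<phi> (a * a') (b * b')) t) s"
proof -
  have pure: "tensor_lift sA sB \<phi> (tensor_mult sA sB (pure_tensor sA sB a b) t) =
      tensor_lift sA sB (\<lambda>a' b'. \<phi> (a * a') (b * b')) t" for a b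
    using t by (induction rule: tensor_space_induct)
      (simp_all add: tensor_mult_0_right tensor_mult_add_right tensor_mult_pure tensor_mult_closed
        tensor_lift_0[OF \<phi>] tensor_lift_add[OF \<phi>] tensor_lift_pure[OF \<phi>]
        tensor_lift_0[OF bilinear_shift(1)[OF \<phi>]] tensor_lift_add[OF bilinear_shift(1)[OF \<phi>]]
        tensor_lift_pure[OF bilinear_shift(1)[OF \<phi>]])
  note b = bilinear_lift_shift[OF \<phi> t]
  show ?thesis
    using s by (induction rule: tensor_space_induct)
      (simp_all add: tensor_mult_0_left t tensor_mult_add_left tensor_mult_closed pure
        tensor_lift_0[OF \<phi>] tensor_lift_add[OF \<phi>] tensor_lift_0[OF b] tensor_lift_add[OF b]
        tensor_lift_pure[OF b])
qed

lemma tensor_mult_assoc: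
  assumes r: "r \<in> tensor_space sA sB" and s: "s \<in> tensor_space sA sB" and t: "t \<in> tensor_space sA sB"
  shows "tensor_mult sA sB (tensor_mult sA sB r s) t = tensor_mult sA sB r (tensor_mult sA sB s t)"
proof -
  have 1: "tensor_mult sA sB (pure_tensor sA sB a b) (tensor_mult sA sB (pure_tensor sA sB a' b') t)
    = tensor_mult sA sB (pure_tensor sA sB (a * a') (b * b')) t" for a b a' b'
    using t by (induction rule: tensor_space_induct)
      (simp_all add: tensor_mult_0_right tensor_mult_add_right tensor_mult_closed tensor_mult_pure mult.assoc)
  have 2: "tensor_mult sA sB (tensor_mult sA sB (pure_tensor sA sB a b) s) t =
      tensor_mult sA sB (pure_tensor sA sB a b) (tensor_mult sA sB s t)" for a b
    using s by (induction rule: tensor_space_induct)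
      (simp_all add: t 1 tensor_mult_0_left tensor_mult_0_right tensor_mult_add_left
        tensor_mult_add_right tensor_mult_closed tensor_mult_pure)
  show ?thesis
    using r by (induction rule: tensor_space_induct)
      (simp_all add: s t 2 tensor_mult_0_left tensor_mult_add_left tensor_mult_closed)
qed

lemma tensor_mult_one_left:
  assumes "t \<in> tensor_space sA sB"
  shows "tensor_mult sA sB (pure_tensor sA sB 1 1) t = t"
  using assms by (induction rule: tensor_space_induct)
    (simp_all add: tensor_mult_0_right tensor_mult_add_right tensor_mult_pure)

lemma tensor_mult_one_right:
  assumes "t \<in> tensor_space sA sB"
  shows "tensor_mult sA sB t (pure_tensor sA sB 1 1) = t"
  using assms by (induction rule: tensor_space_induct)
    (simp_all add: tensor_mult_0_left tensor_mult_add_left tensor_mult_pure)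

end


section \<open>Free algebras and algebras given by generators and relations\<close>

text \<open>
  Words in the generators, written additively because a monoid algebra is
  \<^typ>\<open>'w::monoid_add \<Rightarrow>\<^sub>0 'k\<close> in the library.
\<close>

datatype 'g nc_word = Nc_Word (letters: "'g list")

instantiation nc_word :: (type) monoid_add
begin

definition "0 = Nc_Word []"
definition "v + w = Nc_Word (letters v @ letters w)"

instance by standard (simp_all add: zero_nc_word_def plus_nc_word_def)

end

type_synonym ('k, 'g) free_algebra = "'g nc_word \<Rightarrow>\<^sub>0 'k"

definition free_gen :: "'g \<Rightarrow> ('k::field, 'g) free_algebra"
  where "free_gen x = Poly_Mapping.single (Nc_Word [x]) 1"

definition free_scale :: "'k::field \<Rightarrow> ('k, 'g) free_algebra \<Rightarrow> ('k, 'g) free_algebra"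
  where "free_scale c p = Poly_Mapping.single 0 c * p"

inductive_set two_sided_ideal :: "'a::ring_1 set \<Rightarrow> 'a set" for R where
  zero: "0 \<in> two_sided_ideal R"
| add: "x \<in> two_sided_ideal R \<Longrightarrow> y \<in> two_sided_ideal R \<Longrightarrow> x + y \<in> two_sided_ideal R"
| mult: "r \<in> R \<Longrightarrow> a * r * b \<in> two_sided_ideal R"

text \<open>
  Evaluation of a noncommutative polynomial at \<open>g\<close>, in an algebra with scalar multiplication
  \<open>s\<close>, multiplication \<open>m\<close> and unit \<open>e\<close>. The operations are parameters because \<open>H \<otimes> H\<close> and
  the opposite algebra of \<open>H\<close> are not given by type class instances.
\<close>

definition free_eval ::
    "('k::field \<Rightarrow> 'b::ab_group_add \<Rightarrow> 'b) \<Rightarrow> ('b \<Rightarrow> 'b \<Rightarrow> 'b) \<Rightarrow> 'b \<Rightarrow> ('g \<Rightarrow> 'b) \<Rightarrow>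
     ('k, 'g) free_algebra \<Rightarrow> 'b"
  where "free_eval s m e g p =
    (\<Sum>w\<in>Poly_Mapping.keys p. s (Poly_Mapping.lookup p w) (foldr (\<lambda>x. m (g x)) (letters w) e))"

lemma two_sided_ideal_base: "r \<in> R \<Longrightarrow> r \<in> two_sided_ideal R"
  using two_sided_ideal.mult[of r R 1 1] by simp

lemma two_sided_ideal_uminus: "x \<in> two_sided_ideal R \<Longrightarrow> - x \<in> two_sided_ideal R"
proof (induction rule: two_sided_ideal.induct)
  case (mult r a b)
  thus ?case using two_sided_ideal.mult[of r R "- a" b] by simp
next
  case (add x y)
  thus ?case using two_sided_ideal.add[of "- x" R "- y"] by simp
qed (simp add: two_sided_ideal.zero)

lemma two_sided_ideal_diff:
  "x \<in> two_sided_ideal R \<Longrightarrow> y \<in> two_sided_ideal R \<Longrightarrow> x - y \<in> two_sided_ideal R"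
  using two_sided_ideal.add[of x R "- y"] two_sided_ideal_uminus[of y R] by simp

lemma two_sided_ideal_mult_left: "x \<in> two_sided_ideal R \<Longrightarrow> c * x \<in> two_sided_ideal R"
proof (induction rule: two_sided_ideal.induct)
  case (mult r a b)
  thus ?case using two_sided_ideal.mult[of r R "c * a" b] by (simp add: mult.assoc)
qed (auto intro: two_sided_ideal.intros simp: distrib_left)

lemma two_sided_ideal_mult_right: "x \<in> two_sided_ideal R \<Longrightarrow> x * c \<in> two_sided_ideal R"
proof (induction rule: two_sided_ideal.induct)
  case (mult r a b)
  thus ?case using two_sided_ideal.mult[of r R a "b * c"] by (simp add: mult.assoc)
qed (auto intro: two_sided_ideal.intros simp: distrib_right)

lemma poly_mapping_induct [case_names zero add]:
  assumes "P 0"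
    and "\<And>w c p. P p \<Longrightarrow> P (Poly_Mapping.single w c + p)"
  shows "P (p :: 'w \<Rightarrow>\<^sub>0 'k::comm_monoid_add)"
proof (induction p rule: update_induct)
  case (update p w c)
  have "Poly_Mapping.update w c p = Poly_Mapping.single w c + p"
    by (rule poly_mapping_eqI)
       (use update in \<open>auto simp: lookup_update lookup_add lookup_single in_keys_iff when_def\<close>)
  thus ?case using assms(2)[OF update(3)] by simp
qed (fact assms(1))

lemma free_scale_single:
  "free_scale c (Poly_Mapping.single w d) = Poly_Mapping.single w (c * d)"
  by (simp add: free_scale_def mult_single)

lemma single_0_commute: "Poly_Mapping.single 0 c * p = p * Poly_Mapping.single 0 (c :: 'k::field)"
  by (induction p rule: poly_mapping_induct) (simp_all add: distrib_left distrib_right mult_single mult.commute)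

lemma k_algebra_free: "k_algebra free_scale"
proof
  fix c d :: 'a and x y :: "('a, 'b) free_algebra"
  show "free_scale (c + d) x = free_scale c x + free_scale d x"
    by (simp add: free_scale_def single_add distrib_right)
  show "free_scale c (free_scale d x) = free_scale (c * d) x"
    by (simp add: free_scale_def mult_single flip: mult.assoc)
  show "x * free_scale c y = free_scale c (x * y)"
    unfolding free_scale_def mult.assoc[symmetric] by (simp add: single_0_commute)
qed (simp_all add: free_scale_def distrib_left mult.assoc)

locale eval_target = vector_space s
  for s :: "'k::field \<Rightarrow> 'b::ab_group_add \<Rightarrow> 'b" +
  fixes C :: "'b set" and m :: "'b \<Rightarrow> 'b \<Rightarrow> 'b" and e :: 'b and g :: "'g \<Rightarrow> 'b"
  assumes zero_closed: "0 \<in> C"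
    and add_closed: "x \<in> C \<Longrightarrow> y \<in> C \<Longrightarrow> x + y \<in> C"
    and scale_closed: "x \<in> C \<Longrightarrow> s c x \<in> C"
    and mult_closed: "x \<in> C \<Longrightarrow> y \<in> C \<Longrightarrow> m x y \<in> C"
    and unit_closed: "e \<in> C"
    and gen_closed: "g i \<in> C"
    and add_left: "x \<in> C \<Longrightarrow> y \<in> C \<Longrightarrow> z \<in> C \<Longrightarrow> m (x + y) z = m x z + m y z"
    and add_right: "x \<in> C \<Longrightarrow> y \<in> C \<Longrightarrow> z \<in> C \<Longrightarrow> m z (x + y) = m z x + m z y"
    and scale_left: "x \<in> C \<Longrightarrow> y \<in> C \<Longrightarrow> m (s c x) y = s c (m x y)"
    and scale_right: "x \<in> C \<Longrightarrow> y \<in> C \<Longrightarrow> m x (s c y) = s c (m x y)"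
    and assoc: "x \<in> C \<Longrightarrow> y \<in> C \<Longrightarrow> z \<in> C \<Longrightarrow> m (m x y) z = m x (m y z)"
    and unit_left: "x \<in> C \<Longrightarrow> m e x = x"
    and unit_right: "x \<in> C \<Longrightarrow> m x e = x"
begin

abbreviation "word_eval w \<equiv> foldr (\<lambda>x. m (g x)) (letters w) e"
abbreviation "ev \<equiv> free_eval s m e g"

lemma mult_0_left: "x \<in> C \<Longrightarrow> m 0 x = 0"
  using add_left[of 0 0 x] zero_closed by simp

lemma mult_0_right: "x \<in> C \<Longrightarrow> m x 0 = 0"
  using add_right[of 0 0 x] zero_closed by simp

lemma foldr_closed: "foldr (\<lambda>x. m (g x)) xs e \<in> C"
  by (induction xs) (auto intro: mult_closed unit_closed gen_closed)

lemma foldr_append: "foldr (\<lambda>x. m (g x)) (xs @ ys) e =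
    m (foldr (\<lambda>x. m (g x)) xs e) (foldr (\<lambda>x. m (g x)) ys e)"
  by (induction xs)
     (auto simp: unit_left foldr_closed assoc gen_closed simp del: List.foldr_append
       simp add: List.foldr_append[symmetric])

lemma ev_superset:
  assumes "finite A" "Poly_Mapping.keys p \<subseteq> A"
  shows "ev p = (\<Sum>w\<in>A. s (Poly_Mapping.lookup p w) (word_eval w))"
  unfolding free_eval_def using assms
  by (intro sum.mono_neutral_left) (auto simp: in_keys_iff)

lemma ev_0 [simp]: "ev 0 = 0" by (simp add: free_eval_def)

lemma ev_add: "ev (p + q) = ev p + ev q"
proof -
  let ?A = "Poly_Mapping.keys p \<union> Poly_Mapping.keys q"
  have "ev (p + q) = (\<Sum>w\<in>?A. s (Poly_Mapping.lookup (p + q) w) (word_eval w))"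
    by (rule ev_superset) (auto dest: subsetD[OF keys_add])
  also have "\<dots> = ev p + ev q"
    by (simp add: ev_superset[of ?A] lookup_add scale_left_distrib sum.distrib)
  finally show ?thesis .
qed

lemma ev_single: "ev (Poly_Mapping.single w c) = s c (word_eval w)"
  by (subst ev_superset[of "{w}"]) (auto simp: lookup_single)

lemma ev_closed: "ev p \<in> C"
  by (induction p rule: poly_mapping_induct)
     (auto simp: zero_closed ev_add ev_single intro!: add_closed scale_closed foldr_closed)

lemma ev_mult: "ev (p * q) = m (ev p) (ev q)"
proof (induction p rule: poly_mapping_induct)
  case zero
  thus ?case by (simp add: mult_0_left ev_closed)
next
  case (add w c p)
  have 1: "ev (Poly_Mapping.single w c * q) = m (ev (Poly_Mapping.single w c)) (ev q)"
  proof (induction q rule: poly_mapping_induct)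
    case zero
    thus ?case by (simp add: mult_0_right ev_closed)
  next
    case (add w' c' q)
    have "ev (Poly_Mapping.single w c * Poly_Mapping.single w' c') =
      m (ev (Poly_Mapping.single w c)) (ev (Poly_Mapping.single w' c'))"
      by (simp add: mult_single ev_single plus_nc_word_def foldr_append scale_left scale_right
            foldr_closed mult_closed scale_closed del: List.foldr_append)
    thus ?case using add by (simp add: distrib_left ev_add add_right ev_closed)
  qed
  show ?case by (simp add: distrib_right ev_add add_left ev_closed add 1)
qed

lemma ev_one: "ev 1 = e"
proof -
  have "ev 1 = ev (Poly_Mapping.single 0 1)" by simp
  also have "\<dots> = e" unfolding ev_single by (simp add: zero_nc_word_def)
  finally show ?thesis .
qed

lemma ev_gen: "ev (free_gen x) = g x"
  unfolding free_gen_def by (simp add: ev_single unit_right gen_closed)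

lemma ev_scale: "ev (free_scale c p) = s c (ev p)"
  unfolding free_scale_def ev_mult ev_single
  by (simp add: zero_nc_word_def scale_left unit_closed ev_closed unit_left)

lemma ev_uminus: "ev (- p) = - ev p"
  using ev_add[of p "- p"] by (simp add: eq_neg_iff_add_eq_0 add.commute)

lemma ev_diff: "ev (p - q) = ev p - ev q"
  using ev_add[of p "- q"] ev_uminus[of q] by simp

lemma ev_sum: "ev (\<Sum>x\<in>A. f x) = (\<Sum>x\<in>A. ev (f x))"
  by (induction A rule: infinite_finite_induct) (auto simp: ev_add)

lemma ev_ideal:
  assumes "\<And>r. r \<in> R \<Longrightarrow> ev r = 0" "p \<in> two_sided_ideal R"
  shows "ev p = 0"
  using assms(2)
proof (induction rule: two_sided_ideal.induct)
  case (mult r a b)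
  thus ?case using assms(1) by (simp add: ev_mult mult_0_left mult_0_right ev_closed)
qed (auto simp: ev_add)

end


section \<open>The quantum permutation algebra\<close>

inductive_set qperm_relations :: "('k::field, 'n::finite \<times> 'n) free_algebra set" where
  row_orth: "free_gen (k, i) * free_gen (k, j) - (if i = j then free_gen (k, i) else 0) \<in> qperm_relations"
| row_sum: "(\<Sum>l\<in>UNIV. free_gen (i, l)) - 1 \<in> qperm_relations"
| col_orth: "free_gen (i, k) * free_gen (j, k) - (if i = j then free_gen (i, k) else 0) \<in> qperm_relations"
| col_sum: "(\<Sum>l\<in>UNIV. free_gen (l, i)) - 1 \<in> qperm_relations"

locale qperm_target = eval_target s C m e "\<lambda>(i, j). v i j"
  for s :: "'k::field \<Rightarrow> 'b::ab_group_add \<Rightarrow> 'b" and C m e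
  and v :: "'n::finite \<Rightarrow> 'n \<Rightarrow> 'b" +
  assumes row_orth: "m (v k i) (v k j) = (if i = j then v k i else 0)"
    and row_sum: "(\<Sum>l\<in>UNIV. v i l) = e"
    and col_orth: "m (v i k) (v j k) = (if i = j then v i k else 0)"
    and col_sum: "(\<Sum>l\<in>UNIV. v l i) = e"
begin

lemma ev_relations: "p \<in> two_sided_ideal qperm_relations \<Longrightarrow> ev p = 0"
proof (erule ev_ideal[rotated])
  show "ev r = 0" if "r \<in> qperm_relations" for r
    using that by cases
      (simp_all add: ev_diff ev_mult ev_gen ev_sum ev_one row_orth row_sum col_orth col_sum)
qed

end

lemma one_notin_qperm_ideal:
  "(1 :: ('k::field, 'n::finite \<times> 'n) free_algebra) \<notin> two_sided_ideal qperm_relations"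
proof
  interpret k_algebra "(*) :: 'k \<Rightarrow> 'k \<Rightarrow> 'k" by (rule k_algebra_field)
  interpret qperm_target "(*) :: 'k \<Rightarrow> 'k \<Rightarrow> 'k" UNIV "(*)" 1 "\<lambda>i j :: 'n. of_bool (i = j)"
    by unfold_locales (auto simp: algebra_simps)
  assume "1 \<in> two_sided_ideal (qperm_relations :: ('k, 'n \<times> 'n) free_algebra set)"
  from ev_relations[OF this] show False by (simp add: ev_one)
qed

quotient_type (overloaded) ('k, 'n) qperm = "('k::field, 'n::finite \<times> 'n) free_algebra" /
  "\<lambda>p q. p - q \<in> two_sided_ideal qperm_relations"
proof (rule equivpI)
  show "reflp (\<lambda>p q :: ('k, 'n \<times> 'n) free_algebra. p - q \<in> two_sided_ideal qperm_relations)"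
    by (auto intro!: reflpI two_sided_ideal.zero)
  show "symp (\<lambda>p q :: ('k, 'n \<times> 'n) free_algebra. p - q \<in> two_sided_ideal qperm_relations)"
    using two_sided_ideal_uminus by (intro sympI) fastforce
  show "transp (\<lambda>p q :: ('k, 'n \<times> 'n) free_algebra. p - q \<in> two_sided_ideal qperm_relations)"
    using two_sided_ideal.add by (intro transpI) fastforce
qed

instantiation qperm :: (field, finite) ring_1
begin

lift_definition zero_qperm :: "('a, 'b) qperm" is 0 .
lift_definition one_qperm :: "('a, 'b) qperm" is 1 .
lift_definition plus_qperm :: "('a, 'b) qperm \<Rightarrow> ('a, 'b) qperm \<Rightarrow> ('a, 'b) qperm" is "(+)"
  by (metis add_diff_add two_sided_ideal.add)
lift_definition uminus_qperm :: "('a, 'b) qperm \<Rightarrow> ('a, 'b) qperm" is uminus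
  by (metis minus_diff_minus two_sided_ideal_uminus)
lift_definition minus_qperm :: "('a, 'b) qperm \<Rightarrow> ('a, 'b) qperm \<Rightarrow> ('a, 'b) qperm" is "(-)"
proof -
  fix p p' q q' :: "('a, 'b \<times> 'b) free_algebra"
  assume "p - p' \<in> two_sided_ideal qperm_relations" "q - q' \<in> two_sided_ideal qperm_relations"
  moreover have "p - q - (p' - q') = (p - p') - (q - q')" by simp
  ultimately show "p - q - (p' - q') \<in> two_sided_ideal qperm_relations"
    by (simp only: two_sided_ideal_diff)
qed
lift_definition times_qperm :: "('a, 'b) qperm \<Rightarrow> ('a, 'b) qperm \<Rightarrow> ('a, 'b) qperm" is "(*)"
proof -
  fix p p' q q' :: "('a, 'b \<times> 'b) free_algebra"
  assume "p - p' \<in> two_sided_ideal qperm_relations" "q - q' \<in> two_sided_ideal qperm_relations"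
  moreover have "p * q - p' * q' = (p - p') * q + p' * (q - q')" by (simp add: algebra_simps)
  ultimately show "p * q - p' * q' \<in> two_sided_ideal qperm_relations"
    by (simp only: two_sided_ideal.add two_sided_ideal_mult_left two_sided_ideal_mult_right)
qed

instance
proof
  show "(0 :: ('a, 'b) qperm) \<noteq> 1"
    by transfer (use one_notin_qperm_ideal two_sided_ideal_uminus in fastforce)
qed (transfer; simp add: algebra_simps two_sided_ideal.zero)+

end

lift_definition qperm_scale :: "'k::field \<Rightarrow> ('k, 'n::finite) qperm \<Rightarrow> ('k, 'n) qperm" is free_scale
  by (simp add: free_scale_def two_sided_ideal_mult_left flip: right_diff_distrib)

lift_definition qperm_gen :: "'n::finite \<Rightarrow> 'n \<Rightarrow> ('k::field, 'n) qperm"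
  is "\<lambda>i j. free_gen (i, j)" .

text \<open>
  The linear, multiplicative and unital extension of \<open>u i j \<mapsto> v i j\<close>; it does not depend on the
  choice of representatives if the \<open>v i j\<close> satisfy the defining relations.
\<close>

definition qperm_lift ::
    "('k::field \<Rightarrow> 'b::ab_group_add \<Rightarrow> 'b) \<Rightarrow> ('b \<Rightarrow> 'b \<Rightarrow> 'b) \<Rightarrow> 'b \<Rightarrow>
     ('n::finite \<Rightarrow> 'n \<Rightarrow> 'b) \<Rightarrow> ('k, 'n) qperm \<Rightarrow> 'b"
  where "qperm_lift s m e v x = free_eval s m e (\<lambda>(i, j). v i j) (rep_qperm x)"

definition qperm_comult ::
    "('k::field, 'n::finite) qperm \<Rightarrow> ('k, ('k, 'n) qperm, ('k, 'n) qperm) tensor"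
  where "qperm_comult =
    qperm_lift tensor_scale (tensor_mult qperm_scale qperm_scale)
      (pure_tensor qperm_scale qperm_scale 1 1)
      (\<lambda>i j. \<Sum>k\<in>UNIV. pure_tensor qperm_scale qperm_scale (qperm_gen i k) (qperm_gen k j))"

definition qperm_counit :: "('k::field, 'n::finite) qperm \<Rightarrow> 'k"
  where "qperm_counit = qperm_lift (*) (*) 1 (\<lambda>i j. if i = j then 1 else 0)"

text \<open>An anti-homomorphism, i.e. a homomorphism to the opposite algebra.\<close>

definition qperm_antipode :: "('k::field, 'n::finite) qperm \<Rightarrow> ('k, 'n) qperm"
  where "qperm_antipode = qperm_lift qperm_scale (\<lambda>x y. y * x) 1 (\<lambda>i j. qperm_gen j i)"

text \<open>\<open>e\<^sub>i \<mapsto> \<Sum>\<^sub>k e\<^sub>k \<otimes> u\<^sub>k\<^sub>i\<close>, extended linearly.\<close>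

definition qperm_coaction ::
    "'k ^ 'n \<Rightarrow> ('k::field, 'k ^ 'n::finite, ('k, 'n) qperm) tensor"
  where "qperm_coaction x =
    (\<Sum>i\<in>UNIV. tensor_scale (x $ i)
      (\<Sum>k\<in>UNIV. pure_tensor (*s) qperm_scale (axis k 1) (qperm_gen k i)))"

lemma k_algebra_qperm: "k_algebra (qperm_scale :: 'k::field \<Rightarrow> ('k, 'n::finite) qperm \<Rightarrow> _)"
proof -
  interpret F: k_algebra "free_scale :: 'k \<Rightarrow> ('k, 'n \<times> 'n) free_algebra \<Rightarrow> _" by (rule k_algebra_free)
  show ?thesis
    by unfold_locales
       (transfer; simp add: F.scale_mult_left F.scale_mult_right F.scale_right_distrib
         F.scale_left_distrib two_sided_ideal.zero)+
qed

lemma abs_qperm_eqI: "p - q \<in> qperm_relations \<Longrightarrow> abs_qperm p = abs_qperm q"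
  by (rule qperm.abs_eq_iff[THEN iffD2]) (rule two_sided_ideal_base)

lemma abs_qperm_0: "abs_qperm 0 = 0"
  by (simp only: zero_qperm_def)

lemma abs_qperm_1: "abs_qperm 1 = 1"
  by (simp only: one_qperm_def)

lemma abs_qperm_add: "abs_qperm (p + q) = abs_qperm p + abs_qperm q"
  by (rule plus_qperm.abs_eq[symmetric])

lemma abs_qperm_mult: "abs_qperm (p * q) = abs_qperm p * abs_qperm q"
  by (rule times_qperm.abs_eq[symmetric])

lemma abs_qperm_scale: "abs_qperm (free_scale c p) = qperm_scale c (abs_qperm p)"
  by (rule qperm_scale.abs_eq[symmetric])

lemma abs_qperm_gen: "abs_qperm (free_gen (i, j)) = qperm_gen i j"
  by (rule qperm_gen.abs_eq[symmetric])

lemma abs_qperm_sum: "abs_qperm (\<Sum>x\<in>A. f x) = (\<Sum>x\<in>A. abs_qperm (f x))"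
  by (induction A rule: infinite_finite_induct) (simp_all add: abs_qperm_0 abs_qperm_add)

lemma qperm_gen_row_orth:
  "qperm_gen k i * qperm_gen k j = (if i = j then qperm_gen k i else (0 :: ('k::field, 'n::finite) qperm))"
  using abs_qperm_eqI[OF qperm_relations.row_orth, of k i j]
  by (simp add: abs_qperm_mult abs_qperm_gen abs_qperm_0 split: if_splits)

lemma qperm_gen_col_orth:
  "qperm_gen i k * qperm_gen j k = (if i = j then qperm_gen i k else (0 :: ('k::field, 'n::finite) qperm))"
  using abs_qperm_eqI[OF qperm_relations.col_orth, of i k j]
  by (simp add: abs_qperm_mult abs_qperm_gen abs_qperm_0 split: if_splits)

lemma qperm_gen_row_sum: "(\<Sum>l\<in>UNIV. qperm_gen i l) = (1 :: ('k::field, 'n::finite) qperm)"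
  using abs_qperm_eqI[OF qperm_relations.row_sum, of i]
  by (simp add: abs_qperm_sum abs_qperm_1 abs_qperm_gen)

lemma qperm_gen_col_sum: "(\<Sum>l\<in>UNIV. qperm_gen l i) = (1 :: ('k::field, 'n::finite) qperm)"
  using abs_qperm_eqI[OF qperm_relations.col_sum, of i]
  by (simp add: abs_qperm_sum abs_qperm_1 abs_qperm_gen)

lemma qperm_induct [case_names one add scale gen]:
  assumes "P 1" "\<And>x y. P x \<Longrightarrow> P y \<Longrightarrow> P (x + y)" "\<And>c x. P x \<Longrightarrow> P (qperm_scale c x)"
    and "\<And>i j x. P x \<Longrightarrow> P (qperm_gen i j * x)"
  shows "P (x :: ('k::field, 'n::finite) qperm)"
proof -
  interpret k_algebra "qperm_scale :: 'k \<Rightarrow> ('k, 'n) qperm \<Rightarrow> _" by (rule k_algebra_qperm)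
  have word: "P (abs_qperm (Poly_Mapping.single (Nc_Word xs) 1))" for xs
  proof (induction xs)
    case Nil
    have "abs_qperm (Poly_Mapping.single (Nc_Word []) 1) = (1 :: ('k, 'n) qperm)"
      by (simp flip: zero_nc_word_def add: abs_qperm_1)
    thus ?case using assms(1) by (simp only:)
  next
    case (Cons a xs)
    have "abs_qperm (Poly_Mapping.single (Nc_Word (a # xs)) (1 :: 'k)) =
      qperm_gen (fst a) (snd a) * abs_qperm (Poly_Mapping.single (Nc_Word xs) 1)"
      by (simp add: abs_qperm_gen[symmetric] free_gen_def mult_single plus_nc_word_def
            flip: abs_qperm_mult)
    thus ?case using assms(4)[OF Cons] by (simp only:)
  qed
  have "P (abs_qperm p)" for p
  proof (induction p rule: poly_mapping_induct)
    case zero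
    have "P 0" using assms(3)[OF assms(1), of 0] by simp
    thus ?case by (simp add: abs_qperm_0)
  next
    case (add w c p)
    obtain xs where w: "w = Nc_Word xs" by (cases w)
    have "abs_qperm (Poly_Mapping.single w c + p) =
      qperm_scale c (abs_qperm (Poly_Mapping.single (Nc_Word xs) 1)) + abs_qperm p"
      by (simp add: w abs_qperm_add free_scale_single flip: abs_qperm_scale)
    thus ?case using assms(2)[OF assms(3)[OF word] add] by (simp only:)
  qed
  thus ?thesis by (induct x rule: qperm.abs_induct)
qed

context qperm_target
begin

abbreviation "qev \<equiv> qperm_lift s m e v"

lemma qev_abs: "qev (abs_qperm p) = ev p"
proof -
  have "rep_qperm (abs_qperm p) - p \<in> two_sided_ideal qperm_relations"
    by (rule Quotient3_rep_abs[OF Quotient3_qperm]) (simp add: two_sided_ideal.zero)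
  from ev_relations[OF this] show ?thesis
    unfolding qperm_lift_def by (simp add: ev_diff)
qed

lemma qev_closed: "qev x \<in> C"
  unfolding qperm_lift_def by (rule ev_closed)

lemma qev_add: "qev (x + y) = qev x + qev y"
  by (induct x rule: qperm.abs_induct; induct y rule: qperm.abs_induct) (simp only: qev_abs ev_add flip: abs_qperm_add)

lemma qev_mult: "qev (x * y) = m (qev x) (qev y)"
  by (induct x rule: qperm.abs_induct; induct y rule: qperm.abs_induct) (simp only: qev_abs ev_mult flip: abs_qperm_mult)

lemma qev_scale: "qev (qperm_scale c x) = s c (qev x)"
  by (induct x rule: qperm.abs_induct) (simp only: qev_abs ev_scale flip: abs_qperm_scale)

lemma qev_one: "qev 1 = e"
  by (simp only: qev_abs ev_one flip: abs_qperm_1)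

lemma qev_gen: "qev (qperm_gen i j) = v i j"
  by (simp only: qev_abs ev_gen prod.case flip: abs_qperm_gen)

lemma qev_linear: "Vector_Spaces.linear qperm_scale s qev"
  using k_algebra_qperm vector_space_axioms
  by (auto simp: Vector_Spaces.linear_iff qev_add qev_scale k_algebra_def)

end

lemma tensor_lift_sum_fun:
  fixes sV :: "'k::field \<Rightarrow> 'v::ab_group_add \<Rightarrow> 'v"
  assumes sV: "vector_space sV" and sA: "vector_space sA" and sB: "vector_space sB"
    and \<phi>: "\<And>i. i \<in> I \<Longrightarrow> bilinear_map sA sB sV (\<phi> i)" and t: "t \<in> tensor_space sA sB"
  shows "bilinear_map sA sB sV (\<lambda>a b. \<Sum>i\<in>I. \<phi> i a b) \<and>
    tensor_lift sA sB (\<lambda>a b. \<Sum>i\<in>I. \<phi> i a b) t = (\<Sum>i\<in>I. tensor_lift sA sB (\<phi> i) t)"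
proof -
  interpret V: vector_space sV by fact
  have 0: "bilinear_map sA sB sV (\<lambda>_ _. 0 :: 'v)"
    using sA sB sV by (auto simp: bilinear_map_def Vector_Spaces.linear_iff)
  have 1: "tensor_lift sA sB (\<lambda>_ _. 0 :: 'v) t = 0"
    using t by (induction rule: tensor_space_induct)
      (simp_all add: tensor_lift_0[OF 0] tensor_lift_add[OF 0] tensor_lift_pure[OF 0])
  show ?thesis using \<phi>
    by (induction I rule: infinite_finite_induct)
       (simp_all add: 0 1 tensor_lift_add_fun[where sV = sV, OF _ _ t])
qed

lemma tensor_lift_zero_fun:
  fixes sA :: "'k::field \<Rightarrow> 'a::ab_group_add \<Rightarrow> 'a" and sB :: "'k \<Rightarrow> 'b::ab_group_add \<Rightarrow> 'b"
  assumes "vector_space sA" "vector_space sB" "t \<in> tensor_space sA sB"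
  shows "tensor_lift sA sB (\<lambda>_ _. 0 :: 'a) t = 0"
  using tensor_lift_sum_fun[OF assms(1,1,2) _ assms(3), of "{}"] by simp

lemma linear_tensor_lift_compose:
  assumes F: "Vector_Spaces.linear sA tensor_scale F" "\<And>a. F a \<in> tensor_space sX sY"
    and \<phi>: "bilinear_map sX sY sV \<phi>"
  shows "Vector_Spaces.linear sA sV (\<lambda>a. tensor_lift sX sY \<phi> (F a))"
  using F \<phi>
  by (auto simp: Vector_Spaces.linear_iff tensor_lift_add[OF \<phi>] tensor_lift_scale[OF \<phi>] bilinear_map_def)

lemma trilinear_map_slices:
  assumes "trilinear_map sX sY sB sV \<tau>"
  shows "bilinear_map sX sY sV (\<lambda>x y. \<tau> x y b)" "bilinear_map sY sB sV (\<lambda>y b. \<tau> x y b)"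
  using assms by (auto simp: trilinear_map_def bilinear_map_def)

lemma bilinear_map_lift_left:
  assumes F: "Vector_Spaces.linear sA tensor_scale F" "\<And>a. F a \<in> tensor_space sX sY"
    and \<tau>: "trilinear_map sX sY sB sV \<tau>"
  shows "bilinear_map sA sB sV (\<lambda>a b. tensor_lift sX sY (\<lambda>x y. \<tau> x y b) (F a))"
  unfolding bilinear_map_def
proof (intro conjI allI)
  fix b show "Vector_Spaces.linear sA sV (\<lambda>a. tensor_lift sX sY (\<lambda>x y. \<tau> x y b) (F a))"
    by (intro linear_tensor_lift_compose F trilinear_map_slices(1)[OF \<tau>])
next
  fix a show "Vector_Spaces.linear sB sV (\<lambda>b. tensor_lift sX sY (\<lambda>x y. \<tau> x y b) (F a))"
    using \<tau> by (intro linear_tensor_lift_param F trilinear_map_slices(1))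
      (auto simp: trilinear_map_def Vector_Spaces.linear_iff)
qed

lemma bilinear_map_lift_right:
  assumes F: "Vector_Spaces.linear sB tensor_scale F" "\<And>b. F b \<in> tensor_space sX sY"
    and \<tau>: "trilinear_map sA sX sY sV \<tau>"
  shows "bilinear_map sA sB sV (\<lambda>a b. tensor_lift sX sY (\<lambda>x y. \<tau> a x y) (F b))"
  unfolding bilinear_map_def
proof (intro conjI allI)
  fix a show "Vector_Spaces.linear sB sV (\<lambda>b. tensor_lift sX sY (\<lambda>x y. \<tau> a x y) (F b))"
    by (intro linear_tensor_lift_compose F trilinear_map_slices(2)[OF \<tau>])
next
  fix b show "Vector_Spaces.linear sA sV (\<lambda>a. tensor_lift sX sY (\<lambda>x y. \<tau> a x y) (F b))"
    using \<tau> by (intro linear_tensor_lift_param F trilinear_map_slices(2)[OF \<tau>])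
      (auto simp: trilinear_map_def Vector_Spaces.linear_iff)
qed

lemma linear_app: "Vector_Spaces.linear tensor_scale (*) (\<lambda>t. app t \<gamma>)"
  by (auto simp: Vector_Spaces.linear_iff vector_space_tensor_scale vector_space_field)

lemma trilinear_app_pure_tensor3:
  assumes "vector_space sA" "vector_space sB" "vector_space sC"
  shows "trilinear_map sA sB sC (*) (\<lambda>a b c. app (pure_tensor3 sA sB sC a b c) \<gamma>)"
  using trilinear_pure_tensor3[OF assms] vector_space_field
  by (auto simp: trilinear_map_def Vector_Spaces.linear_iff)

lemma app_tensor_map_left:
  assumes F: "Vector_Spaces.linear sA tensor_scale F" "\<And>a. F a \<in> tensor_space sX sY"
    and t: "t \<in> tensor_space sA sB"
    and vs: "vector_space sX" "vector_space sY" "vector_space sB"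
  shows "app (tensor_map_left sA sB sX sY F t) \<gamma> =
    tensor_lift sA sB (\<lambda>a b. tensor_lift sX sY (\<lambda>x y. app (pure_tensor3 sX sY sB x y b) \<gamma>) (F a)) t"
proof -
  note tri = trilinear_pure_tensor3[OF vs]
  have "app (tensor_lift sX sY (\<lambda>x y. pure_tensor3 sX sY sB x y b) (F a)) \<gamma> =
      tensor_lift sX sY (\<lambda>x y. app (pure_tensor3 sX sY sB x y b) \<gamma>) (F a)" for a b
    by (rule app_tensor_lift[OF trilinear_map_slices(1)[OF tri] F(2)])
  thus ?thesis
    unfolding tensor_map_left_def app_tensor_lift[OF bilinear_map_lift_left[OF F tri] t] by simp
qed

lemma app_tensor_map_right:
  assumes F: "Vector_Spaces.linear sB tensor_scale F" "\<And>b. F b \<in> tensor_space sX sY"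
    and t: "t \<in> tensor_space sA sB"
    and vs: "vector_space sA" "vector_space sX" "vector_space sY"
  shows "app (tensor_map_right sA sB sX sY F t) \<gamma> =
    tensor_lift sA sB (\<lambda>a b. tensor_lift sX sY (\<lambda>x y. app (pure_tensor3 sA sX sY a x y) \<gamma>) (F b)) t"
proof -
  note tri = trilinear_pure_tensor3[OF vs]
  have "app (tensor_lift sX sY (\<lambda>x y. pure_tensor3 sA sX sY a x y) (F b)) \<gamma> =
      tensor_lift sX sY (\<lambda>x y. app (pure_tensor3 sA sX sY a x y) \<gamma>) (F b)" for a b
    by (rule app_tensor_lift[OF trilinear_map_slices(2)[OF tri] F(2)])
  thus ?thesis
    unfolding tensor_map_right_def app_tensor_lift[OF bilinear_map_lift_right[OF F tri] t] by simp
qed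

lemma tensor_mult_sum_left:
  assumes "k_algebra sA" "k_algebra sB" "t \<in> tensor_space sA sB"
    "\<And>i. i \<in> I \<Longrightarrow> f i \<in> tensor_space sA sB"
  shows "tensor_mult sA sB (\<Sum>i\<in>I. f i) t = (\<Sum>i\<in>I. tensor_mult sA sB (f i) t)"
  using assms(4) by (induction I rule: infinite_finite_induct)
    (simp_all add: assms(1-3) tensor_mult_0_left tensor_mult_add_left tensor_space_sum)

lemma tensor_mult_sum_right:
  assumes "k_algebra sA" "k_algebra sB" "t \<in> tensor_space sA sB"
    "\<And>i. i \<in> I \<Longrightarrow> f i \<in> tensor_space sA sB"
  shows "tensor_mult sA sB t (\<Sum>i\<in>I. f i) = (\<Sum>i\<in>I. tensor_mult sA sB t (f i))"
  using assms(4) by (induction I rule: infinite_finite_induct)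
    (simp_all add: assms(1-3) tensor_mult_0_right tensor_mult_add_right tensor_space_sum)

lemma pure_tensor_sum:
  assumes "vector_space sA" "vector_space sB"
  shows "pure_tensor sA sB (\<Sum>i\<in>I. f i) b = (\<Sum>i\<in>I. pure_tensor sA sB (f i) b)"
    and "pure_tensor sA sB a (\<Sum>i\<in>I. g i) = (\<Sum>i\<in>I. pure_tensor sA sB a (g i))"
    and "pure_tensor sA sB 0 b = 0" and "pure_tensor sA sB a 0 = 0"
proof -
  note bil = bilinear_pure_tensor[OF assms]
  have 1: "pure_tensor sA sB (a + a') b = pure_tensor sA sB a b + pure_tensor sA sB a' b"
    "pure_tensor sA sB a (b + b') = pure_tensor sA sB a b + pure_tensor sA sB a b'" for a a' b b'
    using bil by (auto simp: bilinear_map_def Vector_Spaces.linear_iff)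
  have 0: "pure_tensor sA sB 0 b = 0" for b using 1(1)[of 0 0 b] by simp
  have z: "pure_tensor sA sB a 0 = 0" for a using 1(2)[of a 0 0] by simp
  show "pure_tensor sA sB 0 b = 0" "pure_tensor sA sB a 0 = 0" by (fact 0 z)+
  show "pure_tensor sA sB (\<Sum>i\<in>I. f i) b = (\<Sum>i\<in>I. pure_tensor sA sB (f i) b)"
    by (induction I rule: infinite_finite_induct) (simp_all add: 0 1)
  show "pure_tensor sA sB a (\<Sum>i\<in>I. g i) = (\<Sum>i\<in>I. pure_tensor sA sB a (g i))"
    by (induction I rule: infinite_finite_induct) (simp_all add: z 1)
qed

lemma eval_target_tensor:
  assumes "k_algebra sA" "k_algebra sB" "\<And>i. g i \<in> tensor_space sA sB"
  shows "eval_target tensor_scale (tensor_space sA sB) (tensor_mult sA sB) (pure_tensor sA sB 1 1) g"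
proof -
  interpret A: k_algebra sA by fact
  interpret B: k_algebra sB by fact
  interpret T: vector_space "tensor_scale :: 'a \<Rightarrow> ('a, 'b, 'c) tensor \<Rightarrow> _"
    by (rule vector_space_tensor_scale)
  note AB = A.k_algebra_axioms B.k_algebra_axioms
  show ?thesis
    by unfold_locales
      (auto intro: tensor_space_add tensor_space_scale A.vector_space_axioms B.vector_space_axioms
        tensor_mult_closed[OF AB] assms(3)
        simp: tensor_mult_add_left[OF AB] tensor_mult_add_right[OF AB]
          tensor_mult_scale_left[OF AB] tensor_mult_scale_right[OF AB] tensor_mult_assoc[OF AB]
          tensor_mult_one_left[OF AB] tensor_mult_one_right[OF AB])
qed

lemma sum_delta_orth:
  fixes f :: "'n::finite \<Rightarrow> 'n \<Rightarrow> 'b::comm_monoid_add"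
  assumes "\<And>a b. a \<noteq> b \<Longrightarrow> f a b = 0"
  shows "(\<Sum>a\<in>UNIV. \<Sum>b\<in>UNIV. f a b) = (\<Sum>a\<in>UNIV. f a a)"
proof (rule sum.cong[OF refl])
  fix a
  have "(\<Sum>b\<in>UNIV. f a b) = (\<Sum>b\<in>{a}. f a b)"
    by (rule sum.mono_neutral_right) (use assms in auto)
  thus "(\<Sum>b\<in>UNIV. f a b) = f a a" by simp
qed

interpretation qperm: k_algebra "qperm_scale :: 'k::field \<Rightarrow> ('k, 'n::finite) qperm \<Rightarrow> _"
  by (rule k_algebra_qperm)

lemmas qperm_vs = qperm.vector_space_axioms
lemmas qperm_pure_simps =
  pure_tensor_sum[OF qperm_vs qperm_vs] tensor_mult_pure[OF k_algebra_qperm k_algebra_qperm]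

interpretation qperm_comult: qperm_target tensor_scale
    "tensor_space qperm_scale qperm_scale" "tensor_mult qperm_scale qperm_scale"
    "pure_tensor qperm_scale qperm_scale 1 (1 :: ('k::field, 'n::finite) qperm)"
    "\<lambda>i j. \<Sum>k\<in>UNIV. pure_tensor qperm_scale qperm_scale (qperm_gen i k) (qperm_gen k j)"
proof (intro qperm_target.intro eval_target_tensor k_algebra_qperm qperm_target_axioms.intro)
  let ?p = "pure_tensor qperm_scale qperm_scale :: ('k, 'n) qperm \<Rightarrow> ('k, 'n) qperm \<Rightarrow> _"
  let ?m = "tensor_mult qperm_scale qperm_scale :: ('k, ('k, 'n) qperm, ('k, 'n) qperm) tensor \<Rightarrow> _"
  let ?u = "qperm_gen :: 'n \<Rightarrow> 'n \<Rightarrow> ('k, 'n) qperm"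
  note q = k_algebra_qperm[where 'k='k and 'n='n]
  have prod: "?m (\<Sum>a\<in>UNIV. ?p (?u i a) (?u a j)) (\<Sum>b\<in>UNIV. ?p (?u i' b) (?u b j')) =
    (\<Sum>a\<in>UNIV. \<Sum>b\<in>UNIV. ?p (?u i a * ?u i' b) (?u a j * ?u b j'))" for i j i' j'
    by (subst sum.swap) (simp add: tensor_mult_sum_left[OF q q] tensor_mult_sum_right[OF q q]
          tensor_space_sum qperm_pure_simps)
  show "(case ij of (i, j) \<Rightarrow> \<Sum>k\<in>UNIV. ?p (?u i k) (?u k j)) \<in> tensor_space qperm_scale qperm_scale" for ij
    by (auto split: prod.split intro: tensor_space_sum)
  show "?m (\<Sum>a\<in>UNIV. ?p (?u k a) (?u a i)) (\<Sum>b\<in>UNIV. ?p (?u k b) (?u b j)) =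
    (if i = j then \<Sum>a\<in>UNIV. ?p (?u k a) (?u a i) else 0)" for i j k
    unfolding prod by (subst sum_delta_orth) (auto simp: qperm_gen_row_orth qperm_pure_simps)
  show "?m (\<Sum>a\<in>UNIV. ?p (?u i a) (?u a k)) (\<Sum>b\<in>UNIV. ?p (?u j b) (?u b k)) =
    (if i = j then \<Sum>a\<in>UNIV. ?p (?u i a) (?u a k) else 0)" for i j k
    unfolding prod by (subst sum_delta_orth) (auto simp: qperm_gen_col_orth qperm_pure_simps)
  show "(\<Sum>l\<in>UNIV. \<Sum>k\<in>UNIV. ?p (?u i k) (?u k l)) = ?p 1 1" for i
    by (subst sum.swap) (simp add: qperm_gen_row_sum flip: qperm_pure_simps(1,2))
  show "(\<Sum>l\<in>UNIV. \<Sum>k\<in>UNIV. ?p (?u l k) (?u k i)) = ?p 1 1" for i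
    by (subst sum.swap) (simp add: qperm_gen_col_sum flip: qperm_pure_simps(1,2))
qed

interpretation qperm_counit: qperm_target "(*) :: 'k::field \<Rightarrow> 'k \<Rightarrow> 'k" UNIV "(*)" 1
    "\<lambda>i j :: 'n::finite. if i = j then 1 else 0"
  by (intro qperm_target.intro eval_target.intro eval_target_axioms.intro vector_space_field
      qperm_target_axioms.intro) (auto simp: algebra_simps)

interpretation qperm_antipode: qperm_target "qperm_scale :: 'k::field \<Rightarrow> ('k, 'n::finite) qperm \<Rightarrow> _"
    UNIV "\<lambda>x y. y * x" 1 "\<lambda>i j. qperm_gen j i"
  by (intro qperm_target.intro eval_target.intro eval_target_axioms.intro qperm_vs
      qperm_target_axioms.intro)
    (auto simp: distrib_left distrib_right mult.assoc qperm.scale_mult_left qperm.scale_mult_right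
      qperm_gen_row_orth qperm_gen_col_orth qperm_gen_row_sum qperm_gen_col_sum)

lemma qperm_comult_gen:
  "qperm_comult (qperm_gen i j) =
     (\<Sum>k\<in>UNIV. pure_tensor qperm_scale qperm_scale (qperm_gen i k) (qperm_gen k j))"
  unfolding qperm_comult_def by (rule qperm_comult.qev_gen)

lemma qperm_counit_gen: "qperm_counit (qperm_gen i j) = (if i = j then 1 else 0)"
  unfolding qperm_counit_def by (rule qperm_counit.qev_gen)

lemma qperm_antipode_gen: "qperm_antipode (qperm_gen i j) = qperm_gen j i"
  unfolding qperm_antipode_def by (rule qperm_antipode.qev_gen)

lemmas qperm_comult_simps =
  qperm_comult.qev_add[folded qperm_comult_def] qperm_comult.qev_scale[folded qperm_comult_def]
  qperm_comult.qev_one[folded qperm_comult_def] qperm_comult.qev_mult[folded qperm_comult_def]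

lemmas qperm_counit_simps =
  qperm_counit.qev_add[folded qperm_counit_def] qperm_counit.qev_scale[folded qperm_counit_def]
  qperm_counit.qev_one[folded qperm_counit_def] qperm_counit.qev_mult[folded qperm_counit_def]

lemmas qperm_antipode_simps =
  qperm_antipode.qev_add[folded qperm_antipode_def] qperm_antipode.qev_scale[folded qperm_antipode_def]
  qperm_antipode.qev_one[folded qperm_antipode_def] qperm_antipode.qev_mult[folded qperm_antipode_def]

lemmas qperm_comult_closed = qperm_comult.qev_closed[folded qperm_comult_def]
lemmas qperm_comult_linear = qperm_comult.qev_linear[folded qperm_comult_def]
lemmas qperm_counit_linear = qperm_counit.qev_linear[folded qperm_counit_def]
lemmas qperm_antipode_linear = qperm_antipode.qev_linear[folded qperm_antipode_def]

lemma qperm_lift_comult_gen: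
  assumes \<phi>: "bilinear_map qperm_scale qperm_scale sV \<phi>"
  shows "tensor_lift qperm_scale qperm_scale \<phi> (qperm_comult (qperm_gen i j * x)) =
    (\<Sum>k\<in>UNIV. tensor_lift qperm_scale qperm_scale
      (\<lambda>a b. \<phi> (qperm_gen i k * a) (qperm_gen k j * b)) (qperm_comult x))"
proof -
  note q = k_algebra_qperm
  have "tensor_lift qperm_scale qperm_scale \<phi> (qperm_comult (qperm_gen i j * x)) =
    tensor_lift qperm_scale qperm_scale
      (\<lambda>a b. tensor_lift qperm_scale qperm_scale (\<lambda>a' b'. \<phi> (a * a') (b * b')) (qperm_comult x))
      (\<Sum>k\<in>UNIV. pure_tensor qperm_scale qperm_scale (qperm_gen i k) (qperm_gen k j))"
    unfolding qperm_comult_simps qperm_comult_gen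
    by (rule tensor_lift_mult[OF q q \<phi>]) (simp_all add: tensor_space_sum qperm_comult_closed)
  also have "\<dots> = (\<Sum>k\<in>UNIV. tensor_lift qperm_scale qperm_scale
      (\<lambda>a b. \<phi> (qperm_gen i k * a) (qperm_gen k j * b)) (qperm_comult x))"
    by (simp add: tensor_lift_sum[OF bilinear_lift_shift[OF q q \<phi> qperm_comult_closed]]
          tensor_lift_pure[OF bilinear_lift_shift[OF q q \<phi> qperm_comult_closed]])
  finally show ?thesis .
qed

lemma qperm_coassoc_form:
  fixes \<tau> :: "('k::field, 'n::finite) qperm \<Rightarrow> _"
  assumes "trilinear_map qperm_scale qperm_scale qperm_scale (*) \<tau>"
  shows "tensor_lift qperm_scale qperm_scale
      (\<lambda>a b. tensor_lift qperm_scale qperm_scale (\<lambda>p q. \<tau> p q b) (qperm_comult a)) (qperm_comult x) =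
    tensor_lift qperm_scale qperm_scale
      (\<lambda>a b. tensor_lift qperm_scale qperm_scale (\<lambda>p q. \<tau> a p q) (qperm_comult b)) (qperm_comult x)"
  using assms
proof (induction x arbitrary: \<tau> rule: qperm_induct)
  case one
  note b = bilinear_map_lift_left[OF qperm_comult_linear qperm_comult_closed one]
    bilinear_map_lift_right[OF qperm_comult_linear qperm_comult_closed one]
  show ?case
    by (simp add: qperm_comult_simps tensor_lift_pure[OF b(1)] tensor_lift_pure[OF b(2)]
          tensor_lift_pure[OF trilinear_map_slices(1)[OF one]]
          tensor_lift_pure[OF trilinear_map_slices(2)[OF one]])
next
  case (add x y)
  note b = bilinear_map_lift_left[OF qperm_comult_linear qperm_comult_closed add.prems]
    bilinear_map_lift_right[OF qperm_comult_linear qperm_comult_closed add.prems]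
  show ?case using add.IH[OF add.prems]
    by (simp add: qperm_comult_simps tensor_lift_add[OF b(1)] tensor_lift_add[OF b(2)]
          qperm_comult_closed)
next
  case (scale c x)
  note b = bilinear_map_lift_left[OF qperm_comult_linear qperm_comult_closed scale.prems]
    bilinear_map_lift_right[OF qperm_comult_linear qperm_comult_closed scale.prems]
  show ?case using scale.IH[OF scale.prems]
    by (simp add: qperm_comult_simps tensor_lift_scale[OF b(1)] tensor_lift_scale[OF b(2)]
          qperm_comult_closed)
next
  case (gen i j x)
  let ?\<tau> = "\<lambda>k l p q b. \<tau> (qperm_gen i l * p) (qperm_gen l k * q) (qperm_gen k j * b)"
  let ?L = "tensor_lift qperm_scale qperm_scale"
  have \<tau>: "trilinear_map qperm_scale qperm_scale qperm_scale (*) (?\<tau> k l)" for k l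
    using gen.prems unfolding trilinear_map_def Vector_Spaces.linear_iff
    by (auto simp: distrib_left qperm.scale_mult_right)
  note b1 = bilinear_map_lift_left[OF qperm_comult_linear qperm_comult_closed]
  note b2 = bilinear_map_lift_right[OF qperm_comult_linear qperm_comult_closed]
  note sum_fun = tensor_lift_sum_fun[OF vector_space_field qperm_vs qperm_vs, THEN conjunct2]
  have "?L (\<lambda>a b. ?L (\<lambda>p q. \<tau> p q b) (qperm_comult a)) (qperm_comult (qperm_gen i j * x)) =
    (\<Sum>k\<in>UNIV. \<Sum>l\<in>UNIV. ?L (\<lambda>a b. ?L (\<lambda>p q. ?\<tau> k l p q b) (qperm_comult a)) (qperm_comult x))"
    by (simp add: qperm_lift_comult_gen[OF b1[OF gen.prems]]
          qperm_lift_comult_gen[OF trilinear_map_slices(1)[OF gen.prems]]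
          sum_fun[OF b1[OF \<tau>] qperm_comult_closed])
  also have "\<dots> = (\<Sum>l\<in>UNIV. \<Sum>k\<in>UNIV. ?L (\<lambda>a b. ?L (\<lambda>p q. ?\<tau> k l a p q) (qperm_comult b)) (qperm_comult x))"
    by (subst sum.swap) (simp add: gen.IH[OF \<tau>])
  also have "\<dots> = ?L (\<lambda>a b. ?L (\<lambda>p q. \<tau> a p q) (qperm_comult b)) (qperm_comult (qperm_gen i j * x))"
    by (simp add: qperm_lift_comult_gen[OF b2[OF gen.prems]]
          qperm_lift_comult_gen[OF trilinear_map_slices(2)[OF gen.prems]]
          sum_fun[OF b2[OF \<tau>] qperm_comult_closed])
  finally show ?case .
qed

theorem hopf_algebra_qperm:
  "hopf_algebra (qperm_scale :: 'k::field \<Rightarrow> ('k, 'n::finite) qperm \<Rightarrow> _)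
     qperm_comult qperm_counit qperm_antipode"
proof (intro hopf_algebra.intro hopf_algebra_axioms.intro k_algebra_qperm)
  let ?s = "qperm_scale :: 'k \<Rightarrow> ('k, 'n) qperm \<Rightarrow> _"
  let ?L = "tensor_lift ?s ?s"
  fix x y :: "('k, 'n) qperm"
  show "qperm_comult x \<in> tensor_space ?s ?s" by (rule qperm_comult_closed)
  show "Vector_Spaces.linear ?s tensor_scale qperm_comult" by (rule qperm_comult_linear)
  show "qperm_comult 1 = pure_tensor ?s ?s 1 1" by (rule qperm_comult_simps)
  show "qperm_comult (x * y) = tensor_mult ?s ?s (qperm_comult x) (qperm_comult y)"
    by (rule qperm_comult_simps)
  show "tensor_map_left ?s ?s ?s ?s qperm_comult (qperm_comult x) =
      tensor_map_right ?s ?s ?s ?s qperm_comult (qperm_comult x)"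
    by (rule functional_eqI)
       (simp add: app_tensor_map_left[OF qperm_comult_linear qperm_comult_closed qperm_comult_closed qperm_vs qperm_vs qperm_vs]
         app_tensor_map_right[OF qperm_comult_linear qperm_comult_closed qperm_comult_closed qperm_vs qperm_vs qperm_vs]
         qperm_coassoc_form[OF trilinear_app_pure_tensor3[OF qperm_vs qperm_vs qperm_vs]])
  show "algebra_hom ?s (*) qperm_counit"
    by (simp add: algebra_hom_def qperm_counit_linear qperm_counit_simps)
  show "Vector_Spaces.linear ?s ?s qperm_antipode" by (rule qperm_antipode_linear)

  have bil: "bilinear_map ?s ?s ?s (\<lambda>a b. ?s (qperm_counit a) b)"
    "bilinear_map ?s ?s ?s (\<lambda>a b. ?s (qperm_counit b) a)"
    "bilinear_map ?s ?s ?s (\<lambda>a b. qperm_antipode a * b)"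
    "bilinear_map ?s ?s ?s (\<lambda>a b. a * qperm_antipode b)"
    by (auto simp: bilinear_map_def Vector_Spaces.linear_iff qperm_vs qperm_counit_simps
          qperm_antipode_simps qperm.scale_left_distrib qperm.scale_right_distrib distrib_left
          distrib_right qperm.scale_mult_left qperm.scale_mult_right mult.commute)
  have lin: "Vector_Spaces.linear ?s ?s (\<lambda>x. c * x)" "Vector_Spaces.linear ?s ?s (\<lambda>x. x * c)" for c
    by (auto simp: Vector_Spaces.linear_iff qperm_vs distrib_left distrib_right
          qperm.scale_mult_left qperm.scale_mult_right)
  note zero = tensor_lift_zero_fun[OF qperm_vs qperm_vs qperm_comult_closed]
  note base = qperm_comult_simps qperm_counit_simps qperm_antipode_simps qperm_comult_closed
    qperm.scale_left_distrib qperm.scale_right_distrib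
  note lift = tensor_lift_pure tensor_lift_add tensor_lift_scale

  show "?L (\<lambda>a b. ?s (qperm_counit a) b) (qperm_comult x) = x"
  proof (induction x rule: qperm_induct)
    case (gen i j x)
    have "?L (\<lambda>a b. ?s (qperm_counit (qperm_gen i k * a)) (qperm_gen k j * b)) (qperm_comult x) =
        (if i = k then qperm_gen k j * x else 0)" for k
      using linear_tensor_lift[OF bil(1) lin(1) qperm_comult_closed, of "qperm_gen k j" x]
      by (simp add: gen qperm_counit_simps qperm_counit_gen qperm.scale_mult_right zero)
    thus ?case by (simp add: qperm_lift_comult_gen[OF bil(1)])
  qed (simp_all add: base lift[OF bil(1)])

  show "?L (\<lambda>a b. ?s (qperm_counit b) a) (qperm_comult x) = x"
  proof (induction x rule: qperm_induct)
    case (gen i j x)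
    have "?L (\<lambda>a b. ?s (qperm_counit (qperm_gen k j * b)) (qperm_gen i k * a)) (qperm_comult x) =
        (if j = k then qperm_gen i k * x else 0)" for k
      using linear_tensor_lift[OF bil(2) lin(1) qperm_comult_closed, of "qperm_gen i k" x]
      by (simp add: gen qperm_counit_simps qperm_counit_gen qperm.scale_mult_right zero)
    thus ?case by (simp add: qperm_lift_comult_gen[OF bil(2)])
  qed (simp_all add: base lift[OF bil(2)])

  show "?L (\<lambda>a b. qperm_antipode a * b) (qperm_comult x) = ?s (qperm_counit x) 1"
  proof (induction x rule: qperm_induct)
    case (gen i j x)
    have b: "bilinear_map ?s ?s ?s (\<lambda>a b. qperm_antipode a * (qperm_gen k i * b))" for k
      by (auto simp: bilinear_map_def Vector_Spaces.linear_iff qperm_vs qperm_antipode_simps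
            distrib_left distrib_right qperm.scale_mult_left qperm.scale_mult_right)
    have e: "qperm_antipode (qperm_gen i k * a) * (qperm_gen k j * b) =
        (if i = j then qperm_antipode a * (qperm_gen k i * b) else 0)" for k a b
    proof -
      have "qperm_antipode (qperm_gen i k * a) * (qperm_gen k j * b) =
          qperm_antipode a * ((qperm_gen k i * qperm_gen k j) * b)"
        by (simp add: qperm_antipode_simps qperm_antipode_gen mult.assoc)
      thus ?thesis by (simp only: qperm_gen_row_orth) simp
    qed
    have "?L (\<lambda>a b. qperm_antipode a * b) (qperm_comult (qperm_gen i j * x)) =
        (if i = j then \<Sum>k\<in>UNIV. ?L (\<lambda>a b. qperm_antipode a * (qperm_gen k i * b)) (qperm_comult x) else 0)"
      by (simp only: qperm_lift_comult_gen[OF bil(3)] e) (simp add: zero)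
    also have "(\<Sum>k\<in>UNIV. ?L (\<lambda>a b. qperm_antipode a * (qperm_gen k i * b)) (qperm_comult x)) =
        ?L (\<lambda>a b. \<Sum>k\<in>UNIV. qperm_antipode a * (qperm_gen k i * b)) (qperm_comult x)"
      by (rule tensor_lift_sum_fun[OF qperm_vs qperm_vs qperm_vs b qperm_comult_closed, THEN conjunct2, symmetric])
    also have "\<dots> = ?s (qperm_counit x) 1"
      by (simp add: qperm_gen_col_sum gen flip: sum_distrib_left sum_distrib_right)
    finally show ?case by (simp add: qperm_counit_simps qperm_counit_gen)
  qed (simp_all add: base lift[OF bil(3)])

  show "?L (\<lambda>a b. a * qperm_antipode b) (qperm_comult x) = ?s (qperm_counit x) 1"
  proof (induction x rule: qperm_induct)
    case (gen i j x)
    have "?L (\<lambda>a b. (qperm_gen i k * a) * qperm_antipode (qperm_gen k j * b)) (qperm_comult x) =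
        ?s (qperm_counit x) (if i = j then qperm_gen i k else 0)" for k
    proof -
      have "?L (\<lambda>a b. (qperm_gen i k * a) * qperm_antipode (qperm_gen k j * b)) (qperm_comult x) =
          ?L (\<lambda>a b. qperm_gen i k * (a * qperm_antipode b) * qperm_gen j k) (qperm_comult x)"
        by (simp add: qperm_antipode_simps qperm_antipode_gen mult.assoc)
      also have "\<dots> = qperm_gen i k * ?L (\<lambda>a b. a * qperm_antipode b) (qperm_comult x) * qperm_gen j k"
        using linear_tensor_lift[OF bil(4) lin(1) qperm_comult_closed, of "qperm_gen i k" x]
          linear_tensor_lift[OF bilinear_map_compose[OF bil(4) lin(1)] lin(2) qperm_comult_closed,
            of "qperm_gen i k" x "qperm_gen j k"] by simp
      also have "\<dots> = ?s (qperm_counit x) (qperm_gen i k * qperm_gen j k)"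
        by (simp add: gen qperm.scale_mult_left qperm.scale_mult_right)
      finally show ?thesis by (simp only: qperm_gen_col_orth)
    qed
    thus ?case
      by (simp add: qperm_lift_comult_gen[OF bil(4)] qperm_counit_simps qperm_counit_gen
            qperm_gen_row_sum flip: qperm.scale_sum_right)
  qed (simp_all add: base lift[OF bil(4)])
qed

lemma tensor_lift_qperm_coaction:
  assumes \<phi>: "bilinear_map (*s) qperm_scale sV \<phi>"
  shows "tensor_lift (*s) qperm_scale \<phi> (qperm_coaction x) =
    (\<Sum>i\<in>UNIV. sV (x $ i) (\<Sum>k\<in>UNIV. \<phi> (axis k 1) (qperm_gen k i)))"
  unfolding qperm_coaction_def
  by (simp add: tensor_lift_sum[OF \<phi>] tensor_lift_scale[OF \<phi>] tensor_lift_pure[OF \<phi>]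
        tensor_space_sum tensor_space_scale vec.vector_space_axioms qperm_vs)

lemma qperm_coaction_axis:
  "qperm_coaction (axis i 1) =
    (\<Sum>k\<in>UNIV. pure_tensor (*s) qperm_scale (axis k 1) (qperm_gen k i))"
proof -
  interpret T: vector_space "tensor_scale :: 'a \<Rightarrow> ('a, 'a ^ 'b, ('a, 'b) qperm) tensor \<Rightarrow> _"
    by (rule vector_space_tensor_scale)
  show ?thesis
    unfolding qperm_coaction_def axis_def by (simp add: if_distrib[of "\<lambda>c. tensor_scale c _"] cong: if_cong)
qed

theorem algebra_coaction_qperm:
  "algebra_coaction (*s) qperm_scale qperm_comult qperm_counit
     (qperm_coaction :: 'k::field ^ 'n::finite \<Rightarrow> _)"
proof -
  let ?s = "qperm_scale :: 'k \<Rightarrow> ('k, 'n) qperm \<Rightarrow> _"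
  let ?v = "(*s) :: 'k \<Rightarrow> 'k ^ 'n \<Rightarrow> 'k ^ 'n"
  let ?p = "pure_tensor ?v ?s"
  let ?\<alpha> = "qperm_coaction :: 'k ^ 'n \<Rightarrow> _"
  interpret T: vector_space "tensor_scale :: 'k \<Rightarrow> ('k, 'k ^ 'n, ('k, 'n) qperm) tensor \<Rightarrow> _"
    by (rule vector_space_tensor_scale)
  note vv = vec.vector_space_axioms[where ?'a = 'k and ?'b = 'n]
  have closed: "?\<alpha> x \<in> tensor_space ?v ?s" for x
    unfolding qperm_coaction_def by (intro tensor_space_sum tensor_space_scale vv qperm_vs tensor_space_pure)
  have lin: "Vector_Spaces.linear ?v tensor_scale ?\<alpha>"
    by (auto simp: Vector_Spaces.linear_iff vv vector_space_tensor_scale qperm_coaction_def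
          T.scale_left_distrib sum.distrib T.scale_sum_right)
  have coassoc: "tensor_map_left ?v ?s ?v ?s ?\<alpha> (?\<alpha> x) = tensor_map_right ?v ?s ?s ?s qperm_comult (?\<alpha> x)" for x
  proof (rule functional_eqI)
    fix \<gamma>
    note tri = trilinear_app_pure_tensor3[OF vv qperm_vs qperm_vs, of \<gamma>]
    have 1: "tensor_lift ?v ?s (\<lambda>p q. app (pure_tensor3 ?v ?s ?s p q b) \<gamma>) (?\<alpha> (axis k 1)) =
      (\<Sum>l\<in>UNIV. app (pure_tensor3 ?v ?s ?s (axis l 1) (qperm_gen l k) b) \<gamma>)" for b k
      unfolding qperm_coaction_axis
      by (simp add: tensor_lift_sum[OF trilinear_map_slices(1)[OF tri]]
            tensor_lift_pure[OF trilinear_map_slices(1)[OF tri]])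
    have 2: "tensor_lift ?s ?s (\<lambda>p q. app (pure_tensor3 ?v ?s ?s a p q) \<gamma>) (qperm_comult (qperm_gen l i)) =
      (\<Sum>k\<in>UNIV. app (pure_tensor3 ?v ?s ?s a (qperm_gen l k) (qperm_gen k i)) \<gamma>)" for a l i
      unfolding qperm_comult_gen
      by (simp add: tensor_lift_sum[OF trilinear_map_slices(2)[OF tri]]
            tensor_lift_pure[OF trilinear_map_slices(2)[OF tri]])
    have 3: "(\<Sum>k\<in>UNIV. \<Sum>l\<in>UNIV. app (pure_tensor3 ?v ?s ?s (axis l 1) (qperm_gen l k) (qperm_gen k i)) \<gamma>) =
      (\<Sum>l\<in>UNIV. \<Sum>k\<in>UNIV. app (pure_tensor3 ?v ?s ?s (axis l 1) (qperm_gen l k) (qperm_gen k i)) \<gamma>)" for i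
      by (rule sum.swap)
    show "app (tensor_map_left ?v ?s ?v ?s ?\<alpha> (?\<alpha> x)) \<gamma> =
        app (tensor_map_right ?v ?s ?s ?s qperm_comult (?\<alpha> x)) \<gamma>"
      unfolding app_tensor_map_left[OF lin closed closed vv qperm_vs qperm_vs]
        app_tensor_map_right[OF qperm_comult_linear qperm_comult_closed closed vv qperm_vs qperm_vs]
        tensor_lift_qperm_coaction[OF bilinear_map_lift_left[OF lin closed tri]]
        tensor_lift_qperm_coaction[OF bilinear_map_lift_right[OF qperm_comult_linear qperm_comult_closed tri]]
        1 2 3 ..
  qed
  have counit: "tensor_lift ?v ?s (\<lambda>w h. qperm_counit h *s w) (?\<alpha> x) = x" for x
  proof -
    have b: "bilinear_map ?v ?s ?v (\<lambda>w h. qperm_counit h *s w)"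
      by (auto simp: bilinear_map_def Vector_Spaces.linear_iff vv qperm_vs qperm_counit_simps
            vec_eq_iff algebra_simps)
    have "(\<Sum>k\<in>UNIV. qperm_counit (qperm_gen k i :: ('k, 'n) qperm) *s axis k (1::'k)) = axis i 1" for i :: 'n
    proof -
      have "(\<Sum>k\<in>UNIV. qperm_counit (qperm_gen k i :: ('k, 'n) qperm) *s axis k (1::'k)) =
        (\<Sum>k\<in>UNIV. if k = i then axis k 1 else 0)"
        by (rule sum.cong) (auto simp: qperm_counit_gen)
      thus ?thesis by simp
    qed
    thus ?thesis
      unfolding tensor_lift_qperm_coaction[OF b] by (simp add: basis_expansion)
  qed
  have one: "?\<alpha> 1 = ?p 1 1"
  proof -
    have "(\<Sum>k\<in>UNIV. axis k 1) = (1 :: 'k ^ 'n)"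
      by (simp add: vec_eq_iff axis_def)
    moreover have "?\<alpha> 1 = ?p (\<Sum>k\<in>UNIV. axis k 1) 1"
      unfolding qperm_coaction_def one_index T.scale_one
      by (subst sum.swap) (simp add: pure_tensor_sum[OF vv qperm_vs] qperm_gen_row_sum
            flip: pure_tensor_sum(2)[OF vv qperm_vs])
    ultimately show ?thesis by simp
  qed
  have mult: "?\<alpha> (x * y) = tensor_mult ?v ?s (?\<alpha> x) (?\<alpha> y)" for x y
  proof -
    note b = bilinear_lift_shift[OF k_algebra_vec k_algebra_qperm bilinear_pure_tensor[OF vv qperm_vs] closed]
      bilinear_shift(1)[OF k_algebra_vec k_algebra_qperm bilinear_pure_tensor[OF vv qperm_vs]]
    have ax: "axis k 1 * axis l 1 = (if k = l then axis k 1 else (0 :: 'k ^ 'n))" for k l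
      by (auto simp: vec_eq_iff axis_def)
    have "tensor_scale c (?p (axis k 1 * axis l 1) (qperm_gen k i * qperm_gen l j)) =
      (if k = l then if i = j then tensor_scale c (?p (axis k 1) (qperm_gen k i)) else 0 else 0)"
      for c k l i j
      by (simp add: ax qperm_gen_row_orth pure_tensor_sum[OF vv qperm_vs])
    hence "tensor_mult ?v ?s (?\<alpha> x) (?\<alpha> y) =
      (\<Sum>i\<in>UNIV. \<Sum>k\<in>UNIV. \<Sum>j\<in>UNIV. \<Sum>l\<in>UNIV.
        if k = l then if i = j then tensor_scale (x $ i * y $ j) (?p (axis k 1) (qperm_gen k i)) else 0 else 0)"
      unfolding tensor_mult_def
      unfolding tensor_lift_qperm_coaction[OF b(1)]
      unfolding tensor_lift_qperm_coaction[OF b(2)]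
      by (simp add: T.scale_sum_right del: if_split)
    also have "\<dots> = ?\<alpha> (x * y)"
      by (simp add: qperm_coaction_def T.scale_sum_right)
    finally show ?thesis ..
  qed
  show ?thesis
    unfolding algebra_coaction_def right_comodule_def
    using lin closed coassoc counit one mult by blast
qed

end

theory Submission
  imports Defs
begin

text \<open>
  Write \<open>\<beta> e\<^sub>i = \<Sum>\<^sub>k e\<^sub>k \<otimes> a\<^sub>k\<^sub>i\<close>. The entries of \<open>a\<close> form a multiplicative matrix with inverse \<open>S a\<close>, and
  since \<open>\<beta>\<close> is an algebra map its rows are partitions of unity into orthogonal idempotents, so
  \<open>a\<^sub>i\<^sub>l S(a\<^sub>l\<^sub>j) = \<delta>\<^sub>i\<^sub>j a\<^sub>i\<^sub>l\<close>. Everything reduces to \<open>S(a\<^sub>i\<^sub>j) = a\<^sub>j\<^sub>i\<close>: this turns the row relations into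
  the column relations, which yields the map \<open>u\<^sub>i\<^sub>j \<mapsto> a\<^sub>i\<^sub>j\<close>. If \<open>S\<^sup>2 = id\<close>, apply \<open>S\<close> to
  \<open>a\<^sub>i\<^sub>j S(a\<^sub>j\<^sub>i) = a\<^sub>i\<^sub>j\<close>. If \<open>\<Sum>\<^sub>k w\<^sub>k a\<^sub>k\<^sub>i = w\<^sub>i 1\<close> with scalars \<open>w\<^sub>i\<close>, multiplying by \<open>S(a\<^sub>i\<^sub>l)\<close> gives
  \<open>w\<^sub>i S(a\<^sub>i\<^sub>l) = w\<^sub>l a\<^sub>l\<^sub>i\<close>, which suffices when no \<open>w\<^sub>i\<close> vanishes. Colinearity of \<open>\<psi>\<close> is the case
  \<open>w = 1\<close>; from a Haar measure \<open>h\<close> one gets \<open>w\<^sub>i = \<Sum>\<^sub>k h(a\<^sub>k\<^sub>i)\<close>, and the assumption on the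
  characteristic rules out zeros of \<open>w\<close>.
\<close>

section \<open>Tensor products\<close>

lemma bilinear_map_tensor_lift:
  assumes "vector_space sA" "vector_space sB"
    and "\<And>a b. bilinear_map sC sD sV (\<phi> a b)"
    and "\<And>c d. bilinear_map sA sB sV (\<lambda>a b. \<phi> a b c d)"
    and "t \<in> tensor_space sC sD"
  shows "bilinear_map sA sB sV (\<lambda>a b. tensor_lift sC sD (\<phi> a b) t)"
  unfolding bilinear_map_def
proof (intro conjI allI)
  show "Vector_Spaces.linear sA sV (\<lambda>a. tensor_lift sC sD (\<phi> a b) t)" for b
    by (rule linear_tensor_lift_param[OF assms(1) assms(3) _ assms(5)])
      (use assms(4) in \<open>auto simp: bilinear_map_def\<close>)
  show "Vector_Spaces.linear sB sV (\<lambda>b. tensor_lift sC sD (\<phi> a b) t)" for a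
    by (rule linear_tensor_lift_param[OF assms(2) assms(3) _ assms(5)])
      (use assms(4) in \<open>auto simp: bilinear_map_def\<close>)
qed

text \<open>Fubini for iterated sums over two tensors. Both sides are additive in \<open>s\<close>,
  so induction on \<open>s\<close> suffices, with \<open>t\<close> kept fixed.\<close>

lemma tensor_lift_swap:
  fixes sV :: "'k::field \<Rightarrow> 'v::ab_group_add \<Rightarrow> 'v"
  assumes vs: "vector_space sA" "vector_space sB" "vector_space sC" "vector_space sD"
    and 1: "\<And>a b. bilinear_map sC sD sV (\<phi> a b)"
    and 2: "\<And>c d. bilinear_map sA sB sV (\<lambda>a b. \<phi> a b c d)"
    and s: "s \<in> tensor_space sA sB" and t: "t \<in> tensor_space sC sD"
  shows "tensor_lift sA sB (\<lambda>a b. tensor_lift sC sD (\<phi> a b) t) s =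
    tensor_lift sC sD (\<lambda>c d. tensor_lift sA sB (\<lambda>a b. \<phi> a b c d) s) t"
proof -
  have sV: "vector_space sV"
    using 1 by (auto simp: bilinear_map_def Vector_Spaces.linear_iff)
  note L = bilinear_map_tensor_lift[OF vs(1,2) 1 2 t]
  have R: "bilinear_map sC sD sV (\<lambda>c d. tensor_lift sA sB (\<lambda>a b. \<phi> a b c d) u)"
    if "u \<in> tensor_space sA sB" for u
    by (rule bilinear_map_tensor_lift[OF vs(3,4) 2 1 that])
  show ?thesis
    using s
  proof (induction rule: tensor_space_induct)
    case zero
    \<comment> \<open>The right side lifts the constant map \<open>0\<close>; the empty index set in
      \<open>tensor_lift_sum_fun\<close> shows that this lift is \<open>0\<close>.\<close>
    show ?case
      using tensor_lift_sum_fun[OF sV vs(3,4) _ t, of "{}"]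
      by (simp add: tensor_lift_0[OF L] tensor_lift_0[OF 2])
  next
    case (add a b u)
    thus ?case
      by (simp add: tensor_lift_add[OF L] tensor_lift_pure[OF L] tensor_lift_add[OF 2]
          tensor_lift_pure[OF 2] tensor_lift_add_fun(2)[OF 1 R t])
  qed
qed

text \<open>Elements of \<open>tensor_space\<close> vanish at functions that are not bilinear, so
  two of them agree once their lifts along all bilinear forms agree. This is how the
  comultiplication of a coefficient is identified later.\<close>

lemma app_tensor_space:
  assumes "t \<in> tensor_space sA sB"
  shows "app t \<theta> = (if bilinear_map sA sB (*) \<theta> then tensor_lift sA sB \<theta> t else 0)"
proof (cases "bilinear_map sA sB (*) \<theta>")
  case True
  with assms show ?thesis
    by (induction rule: tensor_space_induct)
      (simp_all add: tensor_lift_0[OF True] tensor_lift_add[OF True] tensor_lift_pure[OF True],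
        simp add: pure_tensor_def)
next
  case False
  with assms show ?thesis
    by (induction rule: tensor_space_induct) (simp_all add: pure_tensor_def)
qed

text \<open>Pulls a pure tensor out of a lift; it serves the generator case in the proof that the
  induced map respects comultiplication.\<close>

lemma tensor_lift_pure_mult_left:
  assumes A: "k_algebra sA" and B: "k_algebra sB"
    and f: "Vector_Spaces.linear sC sA f" and g: "Vector_Spaces.linear sD sB g"
    and t: "t \<in> tensor_space sC sD"
  shows "tensor_lift sC sD (\<lambda>c d. pure_tensor sA sB (x * f c) (y * g d)) t =
    tensor_mult sA sB (pure_tensor sA sB x y) (tensor_map sC sD sA sB f g t)"
proof -
  interpret A: k_algebra sA by fact
  interpret B: k_algebra sB by fact
  have b0: "bilinear_map sA sB tensor_scale (pure_tensor sA sB)"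
    by (rule bilinear_pure_tensor[OF A.vector_space_axioms B.vector_space_axioms])
  have b: "bilinear_map sC sD tensor_scale (\<lambda>c d. pure_tensor sA sB (x * f c) (y * g d))"
    "bilinear_map sC sD tensor_scale (\<lambda>c d. pure_tensor sA sB (f c) (g d))" for x y
    using b0 f g unfolding bilinear_map_def Vector_Spaces.linear_iff
    by (auto simp: distrib_left A.scale_mult_right B.scale_mult_right)
  have "tensor_map sC sD sA sB f g u \<in> tensor_space sA sB" if "u \<in> tensor_space sC sD" for u
    unfolding tensor_map_def by (rule tensor_lift_in_tensor_space[OF b(2) that]) simp
  with t show ?thesis
    by (induction rule: tensor_space_induct)
      (simp_all add: tensor_map_def tensor_lift_0[OF b(1)] tensor_lift_0[OF b(2)]
        tensor_lift_add[OF b(1)] tensor_lift_add[OF b(2)] tensor_lift_pure[OF b(1)]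
        tensor_lift_pure[OF b(2)] tensor_mult_0_right[OF A B] tensor_mult_add_right[OF A B]
        tensor_mult_pure[OF A B])
qed


section \<open>The antipode\<close>

context hopf_algebra
begin

abbreviation "colift \<phi> x \<equiv> tensor_lift scale scale \<phi> (\<Delta> x)"

lemma counit_simps:
  "\<epsilon> (x + y) = \<epsilon> x + \<epsilon> y" "\<epsilon> (scale c x) = c * \<epsilon> x" "\<epsilon> 1 = 1" "\<epsilon> (x * y) = \<epsilon> x * \<epsilon> y"
  using counit_hom by (auto simp: algebra_hom_def Vector_Spaces.linear_iff)

lemma antipode_simps: "S (x + y) = S x + S y" "S (scale c x) = scale c (S x)"
  using antipode_linear by (auto simp: Vector_Spaces.linear_iff)

lemma linear_mult: "Vector_Spaces.linear scale scale (\<lambda>x. c * x)"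
    "Vector_Spaces.linear scale scale (\<lambda>x. x * c)"
  by (auto simp: Vector_Spaces.linear_iff vector_space_axioms distrib_left distrib_right
      scale_mult_left scale_mult_right)

text \<open>The axiom \<open>coassoc\<close> is an equation of functionals on scalar-valued
  trilinear forms. It passes to \<open>\<tau>\<close> with values in H because linear functionals
  \<open>g\<close> separate the points of H.\<close>

lemma coassoc_colift:
  assumes \<tau>: "trilinear_map scale scale scale scale \<tau>"
  shows "colift (\<lambda>a b. colift (\<lambda>p q. \<tau> p q b) a) x = colift (\<lambda>a b. colift (\<lambda>p q. \<tau> a p q) b) x"
proof (rule ccontr)
  note vs = vector_space_axioms
  assume "\<not> ?thesis"
  then obtain g where g: "Vector_Spaces.linear scale (*) g" and
    ne: "g (colift (\<lambda>a b. colift (\<lambda>p q. \<tau> p q b) a) x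
          - colift (\<lambda>a b. colift (\<lambda>p q. \<tau> a p q) b) x) \<noteq> 0"
    using separating_functional[OF vs, of "colift (\<lambda>a b. colift (\<lambda>p q. \<tau> p q b) a) x
          - colift (\<lambda>a b. colift (\<lambda>p q. \<tau> a p q) b) x"] by auto
  define \<gamma> where "\<gamma> = (\<lambda>a b c. g (\<tau> a b c))"
  have \<gamma>: "trilinear_map scale scale scale (*) \<gamma>"
    using \<tau> g by (auto simp: trilinear_map_def Vector_Spaces.linear_iff \<gamma>_def)
  \<comment> \<open>Here trilinearity of \<open>\<gamma>\<close> matters: at other functions
    \<open>pure_tensor3\<close> has the default value \<open>0\<close>.\<close>
  have app: "app (pure_tensor3 scale scale scale a b c) \<gamma> = g (\<tau> a b c)" for a b c
    using \<gamma> by (simp add: pure_tensor3_def) (simp add: \<gamma>_def)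
  have "app (tensor_map_left scale scale scale scale \<Delta> (\<Delta> x)) \<gamma> =
      app (tensor_map_right scale scale scale scale \<Delta> (\<Delta> x)) \<gamma>"
    by (simp add: coassoc)
  hence "colift (\<lambda>a b. colift (\<lambda>p q. g (\<tau> p q b)) a) x =
      colift (\<lambda>a b. colift (\<lambda>p q. g (\<tau> a p q)) b) x"
    by (simp add: app_tensor_map_left[OF comult_linear comult_closed comult_closed vs vs vs]
        app_tensor_map_right[OF comult_linear comult_closed comult_closed vs vs vs] app)
  hence "g (colift (\<lambda>a b. colift (\<lambda>p q. \<tau> p q b) a) x) =
      g (colift (\<lambda>a b. colift (\<lambda>p q. \<tau> a p q) b) x)"
    by (simp add: comult_closed
        linear_tensor_lift[OF bilinear_map_lift_left[OF comult_linear comult_closed \<tau>] g]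
        linear_tensor_lift[OF bilinear_map_lift_right[OF comult_linear comult_closed \<tau>] g]
        linear_tensor_lift[OF trilinear_map_slices(1)[OF \<tau>] g]
        linear_tensor_lift[OF trilinear_map_slices(2)[OF \<tau>] g])
  with ne show False by (simp add: module_hom.diff[OF Vector_Spaces.linear.axioms(3)[OF g]])
qed

text \<open>Convolving \<open>G * id = \<epsilon>(-) c\<close> with the convolution inverse \<open>S\<close> of \<open>id\<close>.\<close>

lemma left_convolution_inverse:
  assumes G: "Vector_Spaces.linear scale scale G"
    and eq: "\<And>y. colift (\<lambda>a b. G a * b) y = scale (\<epsilon> y) c"
  shows "G y = c * S y"
proof -
  note vs = vector_space_axioms
  note Gs = G[unfolded Vector_Spaces.linear_iff]
  note bil_simps = bilinear_map_def trilinear_map_def Vector_Spaces.linear_iff vs Gs counit_simps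
    antipode_simps distrib_left distrib_right scale_mult_left scale_mult_right scale_left_distrib
    scale_right_distrib
  have b1: "bilinear_map scale scale scale (\<lambda>a b. scale (\<epsilon> b) a)"
    "bilinear_map scale scale scale (\<lambda>a b. scale (\<epsilon> a) b)"
    "bilinear_map scale scale scale (\<lambda>a b. G a * b)"
    "bilinear_map scale scale scale (\<lambda>a b. a * S b)"
    by (auto simp: bil_simps mult.commute)
  have \<tau>: "trilinear_map scale scale scale scale (\<lambda>p q r. G p * q * S r)"
    by (auto simp: bil_simps)
  have l: "Vector_Spaces.linear scale scale (\<lambda>z. c * S z)"
    by (auto simp: bil_simps)
  have "G y = G (colift (\<lambda>a b. scale (\<epsilon> b) a) y)" by (simp add: counit_right)
  also have "\<dots> = colift (\<lambda>a b. G a * scale (\<epsilon> b) 1) y"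
    using Gs by (simp add: linear_tensor_lift[OF b1(1) G comult_closed] scale_mult_right)
  \<comment> \<open>The right antipode axiom replaces \<open>scale (\<epsilon> b) 1\<close>, which
    turns G into the convolution of G with (id convolved with S).\<close>
  also have "\<dots> = colift (\<lambda>a b. colift (\<lambda>p q. G a * p * S q) b) y"
    by (simp add: antipode_right[symmetric] linear_tensor_lift[OF b1(4) linear_mult(1) comult_closed]
        mult.assoc)
  also have "\<dots> = colift (\<lambda>a b. colift (\<lambda>p q. G p * q * S b) a) y"
    by (rule coassoc_colift[OF \<tau>, symmetric])
  also have "\<dots> = colift (\<lambda>a b. c * S (scale (\<epsilon> a) b)) y"
    by (simp add: linear_tensor_lift[OF b1(3) linear_mult(2) comult_closed, symmetric] eq
        scale_mult_left scale_mult_right antipode_simps)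
  also have "\<dots> = c * S y"
    using linear_tensor_lift[OF b1(2) l comult_closed, of y] by (simp add: counit_left)
  finally show ?thesis .
qed

lemma antipode_one: "S 1 = 1"
proof -
  have "bilinear_map scale scale scale (\<lambda>a b. S a * b)"
    by (auto simp: bilinear_map_def Vector_Spaces.linear_iff vector_space_axioms antipode_simps
        distrib_left distrib_right scale_mult_left scale_mult_right)
  from tensor_lift_pure[OF this, of 1 1] antipode_left[of 1] show ?thesis
    by (simp add: comult_one counit_simps)
qed

text \<open>The map taking x, y to \<open>S (x * y)\<close> is a convolution inverse of
  multiplication. Cancelling the two factors of the product takes two uses of
  \<open>left_convolution_inverse\<close>, first in y and then in x.\<close>

lemma antipode_mult: "S (x * y) = S y * S x"
proof -
  note vs = vector_space_axioms
  note alg = k_algebra_axioms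
  note bil_simps = bilinear_map_def Vector_Spaces.linear_iff vs antipode_simps distrib_left
    distrib_right scale_mult_left scale_mult_right
  have b0: "bilinear_map scale scale scale (\<lambda>a b. S a * b)"
    by (auto simp: bil_simps)
  have b1: "bilinear_map scale scale scale (\<lambda>a b. S (a * y) * b)" for y
    by (auto simp: bil_simps)
  have b2: "bilinear_map scale scale scale (\<lambda>a b. S (a * a') * (b * b'))" for a' b'
    by (auto simp: bil_simps)
  have b3: "bilinear_map scale scale scale (\<lambda>a' b'. S (a * a') * (b * b'))" for a b
    by (auto simp: bil_simps)
  \<comment> \<open>In essence the left antipode axiom at \<open>x * y\<close>, with the double sum
    reordered so that the sum over \<open>y\<close> is outermost.\<close>
  have 1: "colift (\<lambda>a' b'. colift (\<lambda>a b. S (a * a') * b) x * b') y = scale (\<epsilon> y) (scale (\<epsilon> x) 1)"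
    for x y
  proof -
    have "colift (\<lambda>a' b'. colift (\<lambda>a b. S (a * a') * b) x * b') y =
        colift (\<lambda>a' b'. colift (\<lambda>a b. S (a * a') * (b * b')) x) y"
      by (simp add: linear_tensor_lift[OF b1 linear_mult(2) comult_closed] mult.assoc)
    also have "\<dots> = colift (\<lambda>a b. colift (\<lambda>a' b'. S (a * a') * (b * b')) y) x"
      by (rule tensor_lift_swap[OF vs vs vs vs b2 b3 comult_closed comult_closed])
    also have "\<dots> = colift (\<lambda>a b. S a * b) (x * y)"
      by (simp add: comult_mult tensor_lift_mult[OF alg alg b0 comult_closed comult_closed])
    finally show ?thesis by (simp add: antipode_left counit_simps mult.commute)
  qed
  have lin1: "Vector_Spaces.linear scale scale (\<lambda>y. colift (\<lambda>a b. S (a * y) * b) x)" for x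
    by (rule linear_tensor_lift_param[OF vs b1 _ comult_closed]) (auto simp: bil_simps)
  \<comment> \<open>The constant of \<open>left_convolution_inverse\<close> is
    \<open>scale (\<epsilon> x) 1\<close> here, and \<open>S y\<close> in the final
    application.\<close>
  have 2: "colift (\<lambda>a b. S (a * y) * b) x = scale (\<epsilon> x) (S y)" for x y
    using left_convolution_inverse[OF lin1 1] by (simp add: scale_mult_left)
  have lin2: "Vector_Spaces.linear scale scale (\<lambda>x. S (x * y))"
    by (auto simp: bil_simps)
  show ?thesis by (rule left_convolution_inverse[OF lin2 2])
qed

end


section \<open>Coefficient matrices of coactions\<close>

text \<open>A multiplicative matrix whose rows are partitions of unity, the properties read off from
  a coaction. The column relations are derived later from the antipode.\<close>

locale coaction_matrix = hopf_algebra scale \<Delta> \<epsilon> S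
  for scale :: "'k::field \<Rightarrow> 'h::ring_1 \<Rightarrow> 'h" and \<Delta> \<epsilon> S +
  fixes a :: "'n::finite \<Rightarrow> 'n \<Rightarrow> 'h"
  assumes comult_coeff: "\<Delta> (a i j) = (\<Sum>k\<in>UNIV. pure_tensor scale scale (a i k) (a k j))"
    and counit_coeff: "\<epsilon> (a i j) = (if i = j then 1 else 0)"
    and row_orth: "a k i * a k j = (if i = j then a k i else 0)"
    and row_sum: "(\<Sum>l\<in>UNIV. a i l) = 1"
begin

lemma colift_coeff:
  assumes "bilinear_map scale scale sV \<phi>"
  shows "colift \<phi> (a i j) = (\<Sum>k\<in>UNIV. \<phi> (a i k) (a k j))"
  by (simp add: comult_coeff tensor_lift_sum[OF assms] tensor_lift_pure[OF assms])

lemma coeff_antipode_sum: "(\<Sum>k\<in>UNIV. a i k * S (a k j)) = (if i = j then 1 else 0)"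
proof -
  have "bilinear_map scale scale scale (\<lambda>a b. a * S b)"
    by (auto simp: bilinear_map_def Vector_Spaces.linear_iff vector_space_axioms antipode_simps
        distrib_left distrib_right scale_mult_left scale_mult_right)
  from colift_coeff[OF this, of i j] show ?thesis
    by (cases "i = j") (simp_all add: antipode_right counit_coeff)
qed

text \<open>Multiply \<open>coeff_antipode_sum\<close> on the left by \<open>a i l\<close>: row
  orthogonality keeps only the term \<open>k = l\<close>.\<close>

lemma coeff_antipode: "a i l * S (a l j) = (if i = j then a i l else 0)"
proof -
  have "a i l * (\<Sum>k\<in>UNIV. a i k * S (a k j)) = (\<Sum>k\<in>UNIV. (a i l * a i k) * S (a k j))"
    by (simp add: sum_distrib_left mult.assoc)
  also have "\<dots> = (\<Sum>k\<in>UNIV. if l = k then a i l * S (a k j) else 0)"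
    by (rule sum.cong) (auto simp: row_orth)
  finally show ?thesis by (simp add: coeff_antipode_sum split: if_splits)
qed

section \<open>Criteria for the antipode to transpose the coefficient matrix\<close>

lemma antipode_coeff_weight:
  assumes "\<And>i. (\<Sum>k\<in>UNIV. scale (w k) (a k i)) = scale (w i) 1"
  shows "scale (w i) (S (a i l)) = scale (w l) (a l i)"
proof -
  have "scale (w i) (S (a i l)) = (\<Sum>k\<in>UNIV. scale (w k) (a k i)) * S (a i l)"
    by (simp add: assms scale_mult_left)
  also have "\<dots> = (\<Sum>k\<in>UNIV. if k = l then scale (w k) (a k i) else 0)"
    by (simp add: sum_distrib_right scale_mult_left coeff_antipode if_distrib[of "scale _"]
        cong: if_cong)
  finally show ?thesis by simp
qed

lemma antipode_coeff_if_weight: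
  assumes w: "\<And>i. (\<Sum>k\<in>UNIV. scale (w k) (a k i)) = scale (w i) 1" and "\<And>i. w i \<noteq> 0"
  shows "S (a i j) = a j i"
proof -
  have S: "S (a i j) = scale (w j / w i) (a j i)"
  proof -
    have "S (a i j) = scale (1 / w i) (scale (w i) (S (a i j)))" using assms(2)[of i] by simp
    thus ?thesis unfolding antipode_coeff_weight[OF w] by simp
  qed
  \<comment> \<open>Since \<open>S (a i j)\<close> is a multiple of the idempotent
    \<open>a j i\<close>, that idempotent absorbs it; by \<open>coeff_antipode\<close> the same
    product is \<open>a j i\<close>. The ratio of the weights never has to be computed.\<close>
  hence "a j i * S (a i j) = S (a i j)" by (simp add: scale_mult_right row_orth)
  thus ?thesis by (simp add: coeff_antipode)
qed

lemma antipode_coeff_if_involutive: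
  assumes "\<And>x. S (S x) = x"
  shows "S (a i j) = a j i"
proof -
  \<comment> \<open>By \<open>coeff_antipode\<close> the argument on the left is
    \<open>a i j\<close> and the right side is \<open>a j i\<close>.\<close>
  have "S (a i j * S (a j i)) = a j i * S (a i j)" by (simp only: antipode_mult assms)
  thus ?thesis by (simp add: coeff_antipode)
qed

text \<open>
  Averaging the sum of coordinates with the Haar measure gives an invariant weight \<open>w\<close>. The
  matrix \<open>a\<close> is block diagonal with respect to the zero set \<open>Z\<close> of \<open>w\<close>, so summing \<open>h (a i l)\<close>
  over \<open>Z \<times> Z\<close> by rows and by columns gives \<open>card Z = 0\<close> in the field.
\<close>

lemma antipode_coeff_if_haar:
  assumes h: "haar_measure scale \<Delta> h" and char: "CHAR('k) = 0 \<or> CHAR('k) > CARD('n)"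
  shows "S (a i j) = a j i"
proof -
  interpret h: Vector_Spaces.linear scale "(*)" h
    using h by (simp add: haar_measure_def)
  have h1: "h 1 = 1" and inv: "colift (\<lambda>a b. scale (h a) b) x = scale (h x) 1" for x
    using h by (auto simp: haar_measure_def)
  have bil: "bilinear_map scale scale scale (\<lambda>a b. scale (h a) b)"
    by (auto simp: bilinear_map_def Vector_Spaces.linear_iff vector_space_axioms h.add h.scale
        scale_left_distrib scale_right_distrib mult.commute)
  define w where "w i = (\<Sum>k\<in>UNIV. h (a k i))" for i
  \<comment> \<open>Left invariance of h at \<open>a l i\<close>, summed over
    \<open>l\<close>.\<close>
  have w: "(\<Sum>k\<in>UNIV. scale (w k) (a k i)) = scale (w i) 1" for i
  proof -
    have "(\<Sum>k\<in>UNIV. scale (w k) (a k i)) = (\<Sum>k\<in>UNIV. \<Sum>l\<in>UNIV. scale (h (a l k)) (a k i))"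
      by (simp add: w_def scale_sum_left)
    also have "\<dots> = (\<Sum>l\<in>UNIV. scale (h (a l i)) 1)"
      by (subst sum.swap) (simp add: colift_coeff[OF bil, symmetric] inv)
    finally show ?thesis by (simp add: w_def scale_sum_left)
  qed
  define Z where "Z = {i. w i = 0}"
  have a1: "a l i = 0" if "l \<notin> Z" "i \<in> Z" for l i
    using antipode_coeff_weight[OF w, of i l] that by (simp add: Z_def)
  \<comment> \<open>The opposite block vanishes too: \<open>a i l = a i l * S (a l i)\<close> and
    \<open>a l i = 0\<close>.\<close>
  have a2: "a i l = 0" if "l \<notin> Z" "i \<in> Z" for l i
    using coeff_antipode[of i l i] a1[OF that] antipode_simps(2)[of 0 0] by simp
  \<comment> \<open>Each row sums to \<open>1\<close> and \<open>h 1 = 1\<close>, so every row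
    indexed by Z contributes \<open>1\<close>.\<close>
  have "of_nat (card Z) = (\<Sum>i\<in>Z. \<Sum>l\<in>UNIV. h (a i l))"
    by (simp add: h.sum[symmetric] row_sum h1)
  also have "\<dots> = (\<Sum>i\<in>Z. \<Sum>l\<in>Z. h (a i l))"
    by (intro sum.cong sum.mono_neutral_right) (auto simp: a2)
  also have "\<dots> = (\<Sum>l\<in>Z. \<Sum>i\<in>UNIV. h (a i l))"
    by (subst sum.swap) (intro sum.cong sum.mono_neutral_left; auto simp: a1)
  \<comment> \<open>The inner sums are now full column sums \<open>w l\<close>, which vanish for
    \<open>l\<close> in Z.\<close>
  also have "\<dots> = 0"
    by (simp add: w_def[symmetric] Z_def)
  \<comment> \<open>Divisibility by characteristic \<open>0\<close> forces
    \<open>card Z = 0\<close>; a characteristic above \<open>CARD('n)\<close> exceeds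
    \<open>card Z\<close> and forces the same.\<close>
  finally have "CHAR('k) dvd card Z" by (simp add: of_nat_eq_0_iff_char_dvd)
  moreover have "card Z \<le> CARD('n)" by (rule card_mono) auto
  ultimately have "card Z = 0" using char by (metis dvd_0_left_iff dvd_imp_le leD le_trans not_gr_zero)
  hence "w i \<noteq> 0" for i by (auto simp: Z_def)
  with w show ?thesis by (rule antipode_coeff_if_weight)
qed

section \<open>The Hopf algebra map given by a matrix that the antipode transposes\<close>

context
  assumes antipode_coeff: "\<And>i j. S (a i j) = a j i"
begin

text \<open>Column orthogonality is \<open>coeff_antipode\<close> with the antipode evaluated; the
  column sums are the images under \<open>S\<close> of the row sums.\<close>

lemma qperm_target_coeff: "qperm_target scale UNIV (*) 1 a"
proof (intro qperm_target.intro eval_target.intro eval_target_axioms.intro vector_space_axioms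
    qperm_target_axioms.intro)
  show "a i k * a j k = (if i = j then a i k else 0)" for i j k
    using coeff_antipode[of i k j] by (simp add: antipode_coeff)
  have "(\<Sum>l\<in>UNIV. a l i) = S (\<Sum>l\<in>UNIV. a i l)" for i
    unfolding module_hom.sum[OF Vector_Spaces.linear.axioms(3)[OF antipode_linear]] by (simp add: antipode_coeff)
  thus "(\<Sum>l\<in>UNIV. a l i) = 1" for i
    by (simp add: row_sum antipode_one)
qed (auto simp: distrib_left distrib_right scale_mult_left scale_mult_right mult.assoc row_orth row_sum)

text \<open>Each compatibility is checked by induction along left multiplication by generators. For
  the antipodes this works because both reverse products.\<close>

lemma hopf_algebra_hom_coeff:
  "hopf_algebra_hom qperm_scale qperm_comult qperm_counit qperm_antipode scale \<Delta> \<epsilon> S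
    (qperm_lift scale (*) 1 a)"
proof -
  interpret A: qperm_target scale UNIV "(*)" 1 a by (rule qperm_target_coeff)
  note qevs = A.qev_add A.qev_scale A.qev_one A.qev_mult A.qev_gen
  note vs = vector_space_axioms
  have bil: "bilinear_map qperm_scale qperm_scale tensor_scale
      (\<lambda>x y. pure_tensor scale scale (A.qev x) (A.qev y))"
    using bilinear_pure_tensor[OF vs vs] A.qev_linear
    by (auto simp: bilinear_map_def Vector_Spaces.linear_iff)
  note comult_simps = comult_linear[unfolded Vector_Spaces.linear_iff]
  have closed: "tensor_map qperm_scale qperm_scale scale scale A.qev A.qev (qperm_comult x)
      \<in> tensor_space scale scale" for x
    unfolding tensor_map_def by (rule tensor_lift_in_tensor_space[OF bil qperm_comult_closed]) simp
  have "\<Delta> (A.qev x) = tensor_map qperm_scale qperm_scale scale scale A.qev A.qev (qperm_comult x)" for x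
  proof (induction x rule: qperm_induct)
    case (gen i j x)
    have "tensor_map qperm_scale qperm_scale scale scale A.qev A.qev (qperm_comult (qperm_gen i j * x)) =
      (\<Sum>k\<in>UNIV. tensor_mult scale scale (pure_tensor scale scale (a i k) (a k j))
        (tensor_map qperm_scale qperm_scale scale scale A.qev A.qev (qperm_comult x)))"
      unfolding tensor_map_def qperm_lift_comult_gen[OF bil] qevs
      unfolding tensor_lift_pure_mult_left[OF k_algebra_axioms k_algebra_axioms A.qev_linear
          A.qev_linear qperm_comult_closed] tensor_map_def ..
    also have "\<dots> = tensor_mult scale scale (\<Delta> (a i j)) (\<Delta> (A.qev x))"
      by (simp add: comult_coeff gen closed
          tensor_mult_sum_left[OF k_algebra_axioms k_algebra_axioms])
    finally show ?case by (simp only: qevs comult_mult)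
  qed (simp_all add: qevs comult_simps qperm_comult_simps qperm_comult_closed comult_one
      tensor_map_def tensor_lift_pure[OF bil] tensor_lift_add[OF bil] tensor_lift_scale[OF bil])
  moreover have "\<epsilon> (A.qev x) = qperm_counit x" for x
    by (induction x rule: qperm_induct)
      (simp_all add: qevs counit_simps counit_coeff qperm_counit_simps qperm_counit_gen)
  moreover have "S (A.qev x) = A.qev (qperm_antipode x)" for x
    by (induction x rule: qperm_induct)
      (simp_all add: qevs antipode_simps antipode_one antipode_mult antipode_coeff
        qperm_antipode_simps qperm_antipode_gen)
  ultimately show ?thesis
    by (simp add: hopf_algebra_hom_def algebra_hom_def qevs A.qev_linear)
qed

end
end


section \<open>Coactions on the diagonal algebra\<close>

text \<open>The k-th coordinate functional tensored with the identity of H, after identifying the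
  tensor product of the field with H and H itself.\<close>

definition tensor_coord :: "('k::field \<Rightarrow> 'h::ab_group_add \<Rightarrow> 'h) \<Rightarrow> 'n \<Rightarrow>
    ('k, 'k ^ 'n::finite, 'h) tensor \<Rightarrow> 'h"
  where "tensor_coord sH k = tensor_lift (*s) sH (\<lambda>x h. sH (x $ k) h)"

lemma bilinear_coord:
  assumes "vector_space sH"
  shows "bilinear_map (*s) sH sH (\<lambda>x h. sH (x $ k) h)"
proof -
  interpret vector_space sH by fact
  show ?thesis
    using vec.vector_space_axioms assms
    by (auto simp: bilinear_map_def Vector_Spaces.linear_iff scale_left_distrib scale_right_distrib
        mult.commute)
qed

lemma tensor_coord_sum_axis:
  fixes g :: "'n::finite \<Rightarrow> 'h::ab_group_add" and sH :: "'k::field \<Rightarrow> 'h \<Rightarrow> 'h"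
  assumes "vector_space sH"
  shows "tensor_coord sH k (\<Sum>l\<in>UNIV. pure_tensor (*s) sH (axis l 1) (g l)) = g k"
proof -
  interpret vector_space sH by fact
  note b = bilinear_coord[OF assms]
  have "(\<Sum>l\<in>UNIV. sH (axis l 1 $ k) (g l)) = (\<Sum>l\<in>UNIV. if l = k then g l else 0)"
    by (rule sum.cong) (auto simp: axis_def)
  thus ?thesis
    by (simp add: tensor_coord_def tensor_lift_sum[OF b] tensor_lift_pure[OF b])
qed

text \<open>On a pure tensor, scalars move to the left factor, where the basis expansion applies.
  With \<open>tensor_coord_sum_axis\<close> this gives existence and uniqueness of coefficients in
  H.\<close>

lemma tensor_axis_expansion:
  fixes t :: "('k::field, 'k ^ 'n::finite, 'h::ab_group_add) tensor"
  assumes "vector_space sH" "t \<in> tensor_space (*s) sH"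
  shows "t = (\<Sum>k\<in>UNIV. pure_tensor (*s) sH (axis k 1) (tensor_coord sH k t))"
proof -
  interpret vector_space sH by fact
  note b = bilinear_coord[OF assms(1)]
  have p: "bilinear_map (*s) sH tensor_scale (pure_tensor ((*s) :: 'k \<Rightarrow> 'k ^ 'n \<Rightarrow> _) sH)"
    by (rule bilinear_pure_tensor[OF vec.vector_space_axioms assms(1)])
  have p1: "pure_tensor (*s) sH x (h + h') = pure_tensor (*s) sH x h + pure_tensor (*s) sH x h'"
    "pure_tensor (*s) sH x (sH c h) = pure_tensor (*s) sH (c *s x) h"
    for x :: "'k ^ 'n" and h h' c
    using p by (auto simp: bilinear_map_def Vector_Spaces.linear_iff)
  have "(\<Sum>k\<in>UNIV. pure_tensor (*s) sH (axis k 1) (sH (x $ k) h)) = pure_tensor (*s) sH x h"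
    for x :: "'k ^ 'n" and h
    by (simp add: p1 flip: pure_tensor_sum(1)[OF vec.vector_space_axioms assms(1)])
      (simp add: basis_expansion)
  with assms(2) show ?thesis
    by (induction rule: tensor_space_induct)
      (simp_all add: tensor_coord_def tensor_lift_0[OF b] tensor_lift_add[OF b]
        tensor_lift_pure[OF b] p1 sum.distrib pure_tensor_sum[OF vec.vector_space_axioms assms(1)])
qed

lemma sum_axis: "(\<Sum>k\<in>UNIV. axis k 1) = (1 :: 'k::field ^ 'n::finite)"
  by (simp add: vec_eq_iff axis_def)

lemma axis_mult: "axis k 1 * axis l 1 = (if k = l then axis k 1 else (0 :: 'k::field ^ 'n::finite))"
  by (auto simp: vec_eq_iff axis_def)

text \<open>Comparing coefficients, unitality of \<open>\<beta>\<close> gives the row sums,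
  multiplicativity the row orthogonality, the counit axiom \<open>\<epsilon>\<close>, and
  coassociativity \<open>\<Delta>\<close>.\<close>

lemma coaction_matrix_coord:
  fixes scale :: "'k::field \<Rightarrow> 'h::ring_1 \<Rightarrow> 'h"
    and \<beta> :: "'k::field ^ 'n::finite \<Rightarrow> ('k, 'k ^ 'n, 'h) tensor"
  assumes "hopf_algebra scale \<Delta> \<epsilon> S" and "algebra_coaction (*s) scale \<Delta> \<epsilon> \<beta>"
  shows "coaction_matrix scale \<Delta> \<epsilon> S (\<lambda>k i. tensor_coord scale k (\<beta> (axis i 1)))"
proof -
  interpret hopf_algebra scale \<Delta> \<epsilon> S by fact
  note vs = vector_space_axioms
  note vv = vec.vector_space_axioms[where ?'a = 'k and ?'b = 'n]
  let ?v = "(*s) :: 'k \<Rightarrow> 'k ^ 'n \<Rightarrow> 'k ^ 'n"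
  let ?p = "pure_tensor ?v scale"
  have lin: "Vector_Spaces.linear ?v tensor_scale \<beta>" and closed: "\<beta> x \<in> tensor_space ?v scale"
    and coassoc\<beta>: "tensor_map_left ?v scale ?v scale \<beta> (\<beta> x) = tensor_map_right ?v scale scale scale \<Delta> (\<beta> x)"
    and counit\<beta>: "tensor_lift ?v scale (\<lambda>w h. \<epsilon> h *s w) (\<beta> x) = x"
    and one: "\<beta> 1 = ?p 1 1" and mult: "\<beta> (x * y) = tensor_mult ?v scale (\<beta> x) (\<beta> y)" for x y
    using assms(2) by (auto simp: algebra_coaction_def right_comodule_def)
  interpret \<beta>: Vector_Spaces.linear ?v tensor_scale \<beta> by fact
  define a where "a k i = tensor_coord scale k (\<beta> (axis i 1))" for k i
  have \<beta>: "\<beta> (axis i 1) = (\<Sum>k\<in>UNIV. ?p (axis k 1) (a k i))" for i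
    unfolding a_def by (rule tensor_axis_expansion[OF vs closed])
  have coordI: "f k = g k" if "(\<Sum>l\<in>UNIV. ?p (axis l 1) (f l)) = (\<Sum>l\<in>UNIV. ?p (axis l 1) (g l))"
    for f g k
    using arg_cong[OF that, of "tensor_coord scale k"] by (simp only: tensor_coord_sum_axis[OF vs])
  show ?thesis
    unfolding a_def[symmetric]
  proof (intro coaction_matrix.intro coaction_matrix_axioms.intro assms(1))
    show "(\<Sum>l\<in>UNIV. a i l) = 1" for i
    proof (rule coordI[of "\<lambda>i. \<Sum>l\<in>UNIV. a i l" "\<lambda>_. 1"])
      have "(\<Sum>k\<in>UNIV. ?p (axis k 1) (\<Sum>i\<in>UNIV. a k i)) = (\<Sum>i\<in>UNIV. \<beta> (axis i 1))"
        unfolding pure_tensor_sum(2)[OF vv vs] \<beta> by (rule sum.swap)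
      also have "\<dots> = \<beta> 1" by (simp add: \<beta>.sum[symmetric] sum_axis)
      finally show "(\<Sum>k\<in>UNIV. ?p (axis k 1) (\<Sum>i\<in>UNIV. a k i)) = (\<Sum>k\<in>UNIV. ?p (axis k 1) 1)"
        by (simp add: one sum_axis flip: pure_tensor_sum(1)[OF vv vs])
    qed
    show "a k i * a k j = (if i = j then a k i else 0)" for i j k
    proof (rule coordI[of "\<lambda>k. a k i * a k j" "\<lambda>k. if i = j then a k i else 0"])
      have "\<beta> (axis i 1 * axis j 1) = (\<Sum>l\<in>UNIV. \<Sum>k\<in>UNIV. ?p (axis k 1 * axis l 1) (a k i * a l j))"
        by (simp add: mult \<beta> tensor_mult_sum_left[OF k_algebra_vec k_algebra_axioms]
            tensor_mult_sum_right[OF k_algebra_vec k_algebra_axioms] tensor_space_sum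
            tensor_mult_pure[OF k_algebra_vec k_algebra_axioms])
      \<comment> \<open>Orthogonality of the canonical basis leaves only the diagonal terms.\<close>
      also have "\<dots> = (\<Sum>k\<in>UNIV. ?p (axis k 1) (a k i * a k j))"
        by (subst sum_delta_orth) (auto simp: axis_mult pure_tensor_sum[OF vv vs])
      finally show "(\<Sum>k\<in>UNIV. ?p (axis k 1) (a k i * a k j)) =
          (\<Sum>k\<in>UNIV. ?p (axis k 1) (if i = j then a k i else 0))"
        by (cases "i = j") (simp_all add: axis_mult \<beta> \<beta>.zero pure_tensor_sum[OF vv vs])
    qed
    show "\<epsilon> (a i j) = (if i = j then 1 else 0)" for i j
    proof -
      have b: "bilinear_map ?v scale ?v (\<lambda>w h. \<epsilon> h *s w)"
        by (auto simp: bilinear_map_def Vector_Spaces.linear_iff vv vs counit_simps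
            vec_eq_iff algebra_simps)
      have "axis j 1 = (\<Sum>k\<in>UNIV. \<epsilon> (a k j) *s axis k 1)"
        using counit\<beta>[of "axis j 1"]
        by (simp add: \<beta> tensor_lift_sum[OF b] tensor_lift_pure[OF b])
      hence "axis j 1 $ i = (\<Sum>k\<in>UNIV. \<epsilon> (a k j) *s axis k 1) $ i" by simp
      also have "\<dots> = (\<Sum>k\<in>UNIV. if k = i then \<epsilon> (a k j) else 0)"
        by (simp add: axis_def if_distrib[of "(*) _"] cong: if_cong)
      finally show ?thesis by (auto simp: axis_def)
    qed
    show "\<Delta> (a i j) = (\<Sum>k\<in>UNIV. pure_tensor scale scale (a i k) (a k j))" for i j
    proof (rule functional_eqI)
      fix \<theta> :: "'h \<Rightarrow> 'h \<Rightarrow> 'k"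
      show "app (\<Delta> (a i j)) \<theta> = app (\<Sum>k\<in>UNIV. pure_tensor scale scale (a i k) (a k j)) \<theta>"
      proof (cases "bilinear_map scale scale (*) \<theta>")
        case True
        \<comment> \<open>Testing coassociativity at \<open>\<gamma>\<close> selects the coefficient
          of \<open>axis i 1\<close> in the first factor and applies the form
          \<open>\<theta>\<close> to the other two.\<close>
        define \<gamma> where "\<gamma> = (\<lambda>x p q. (x :: 'k ^ 'n) $ i * \<theta> p q)"
        have \<gamma>: "trilinear_map ?v scale scale (*) \<gamma>"
          using True by (auto simp: trilinear_map_def bilinear_map_def Vector_Spaces.linear_iff
              \<gamma>_def vv algebra_simps)
        have app: "app (pure_tensor3 ?v scale scale x p q) \<gamma> = \<gamma> x p q" for x p q
          using \<gamma> by (simp add: pure_tensor3_def)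
        note b1 = trilinear_map_slices(1)[OF \<gamma>] and b2 = trilinear_map_slices(2)[OF \<gamma>]
        note B1 = bilinear_map_lift_left[OF lin closed \<gamma>]
        note B2 = bilinear_map_lift_right[OF comult_linear comult_closed \<gamma>]
        have \<theta>: "tensor_lift scale scale (\<gamma> x) t = x $ i * tensor_lift scale scale \<theta> t"
          if "t \<in> tensor_space scale scale" for x t
          unfolding \<gamma>_def
          by (rule linear_tensor_lift[OF True vector_space.linear_scale_self[OF vector_space_field]
                that, symmetric])
        have delta: "(\<Sum>l\<in>UNIV. axis l 1 $ i * f l) = f i" for f :: "'n \<Rightarrow> 'k"
        proof -
          have "(\<Sum>l\<in>UNIV. axis l 1 $ i * f l) = (\<Sum>l\<in>UNIV. if l = i then f l else 0)"
            by (rule sum.cong) (auto simp: axis_def)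
          thus ?thesis by simp
        qed
        have "tensor_lift ?v scale (\<lambda>x b. tensor_lift ?v scale (\<lambda>x y. \<gamma> x y b) (\<beta> x)) (\<beta> (axis j 1)) =
            tensor_lift ?v scale (\<lambda>x b. colift (\<lambda>p q. \<gamma> x p q) b) (\<beta> (axis j 1))"
          using arg_cong[OF coassoc\<beta>[of "axis j 1"], of "\<lambda>t. app t \<gamma>"]
          by (simp add: app_tensor_map_left[OF lin closed closed vv vs vs]
              app_tensor_map_right[OF comult_linear comult_closed closed vv vs vs] app)
        hence "(\<Sum>k\<in>UNIV. \<Sum>l\<in>UNIV. \<gamma> (axis l 1) (a l k) (a k j)) =
            (\<Sum>l\<in>UNIV. colift (\<gamma> (axis l 1)) (a l j))"
          by (simp add: \<beta> tensor_lift_sum[OF B1] tensor_lift_pure[OF B1] tensor_lift_sum[OF B2]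
              tensor_lift_pure[OF B2] tensor_lift_sum[OF b1] tensor_lift_pure[OF b1])
        hence "(\<Sum>k\<in>UNIV. \<theta> (a i k) (a k j)) = colift \<theta> (a i j)"
          by (simp add: \<theta> comult_closed delta) (simp add: \<gamma>_def delta)
        thus ?thesis using True
          by (simp add: app_sum app_tensor_space[OF comult_closed] pure_tensor_def)
      next
        case False
        thus ?thesis
          by (simp add: app_sum app_tensor_space[OF comult_closed] pure_tensor_def)
      qed
    qed
  qed
qed

text \<open>Reduces the equation with \<open>\<beta>\<close> to basis vectors: the composite is
  linear, and at \<open>axis i 1\<close> its coefficients are the images of the generators.\<close>

lemma tensor_map_qperm_coaction_axis:
  fixes f :: "('k::field, 'n::finite) qperm \<Rightarrow> 'h::ring_1"
  assumes sH: "vector_space sH" and f: "Vector_Spaces.linear qperm_scale sH f"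
  shows "tensor_map (*s) qperm_scale (*s) sH id f (qperm_coaction (axis i 1)) =
    (\<Sum>k\<in>UNIV. pure_tensor (*s) sH (axis k 1) (f (qperm_gen k i)))"
    and "Vector_Spaces.linear (*s) tensor_scale
      (tensor_map (*s) qperm_scale (*s) sH id f \<circ> qperm_coaction)"
proof -
  note vv = vec.vector_space_axioms[where ?'a = 'k and ?'b = 'n]
  have b: "bilinear_map (*s) qperm_scale tensor_scale
      (\<lambda>x y. pure_tensor (*s) sH (x :: 'k ^ 'n) (f y))"
    using bilinear_pure_tensor[OF vv sH] f by (auto simp: bilinear_map_def Vector_Spaces.linear_iff)
  have "algebra_coaction (*s) qperm_scale qperm_comult qperm_counit
     (qperm_coaction :: 'k ^ 'n \<Rightarrow> _)" by (rule algebra_coaction_qperm)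
  hence *: "Vector_Spaces.linear (*s) tensor_scale (qperm_coaction :: 'k ^ 'n \<Rightarrow> _)"
    "\<And>x :: 'k ^ 'n. qperm_coaction x \<in> tensor_space (*s) qperm_scale"
    by (auto simp: algebra_coaction_def right_comodule_def)
  show "tensor_map (*s) qperm_scale (*s) sH id f (qperm_coaction (axis i 1)) =
    (\<Sum>k\<in>UNIV. pure_tensor (*s) sH (axis k 1) (f (qperm_gen k i)))"
    by (simp add: tensor_map_def qperm_coaction_axis tensor_lift_sum[OF b] tensor_lift_pure[OF b])
  show "Vector_Spaces.linear (*s) tensor_scale
      (tensor_map (*s) qperm_scale (*s) sH id f \<circ> qperm_coaction)"
    unfolding tensor_map_def comp_def id_apply by (rule linear_tensor_lift_compose[OF * b])
qed

lemma linear_vec_eqI: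
  fixes F G :: "'k::field ^ 'n::finite \<Rightarrow> 'v::ab_group_add"
  assumes "Vector_Spaces.linear (*s) sV F" "Vector_Spaces.linear (*s) sV G"
    and "\<And>i. F (axis i 1) = G (axis i 1)"
  shows "F = G"
proof
  fix x :: "'k ^ 'n"
  interpret F: Vector_Spaces.linear "(*s)" sV F by fact
  interpret G: Vector_Spaces.linear "(*s)" sV G by fact
  have "F (\<Sum>i\<in>UNIV. x $ i *s axis i 1) = G (\<Sum>i\<in>UNIV. x $ i *s axis i 1)"
    by (simp only: F.sum G.sum F.scale G.scale assms(3))
  thus "F x = G x" by (simp add: basis_expansion)
qed

theorem theorem3p8:
  fixes scale :: "'k::field \<Rightarrow> 'h::ring_1 \<Rightarrow> 'h"
    and \<Delta> :: "'h \<Rightarrow> ('k, 'h, 'h) tensor" and \<epsilon> :: "'h \<Rightarrow> 'k" and S :: "'h \<Rightarrow> 'h"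
    and \<beta> :: "'k ^ 'n::finite \<Rightarrow> ('k, 'k ^ 'n, 'h) tensor"
  assumes "hopf_algebra scale \<Delta> \<epsilon> S"
    and "algebra_coaction (*s) scale \<Delta> \<epsilon> \<beta>"
    and "comodule_hom (*s) (*) scale \<beta> (trivial_comodule scale) (\<lambda>x. \<Sum>i\<in>UNIV. x $ i)
         \<or> S \<circ> S = id
         \<or> (CHAR('k) = 0 \<or> CHAR('k) > CARD('n)) \<and> cosemisimple scale \<Delta>"
  shows "\<exists>!f :: ('k, 'n) qperm \<Rightarrow> 'h.
    hopf_algebra_hom qperm_scale qperm_comult qperm_counit qperm_antipode scale \<Delta> \<epsilon> S f \<and>
    tensor_map (*s) qperm_scale (*s) scale id f \<circ> qperm_coaction = \<beta>"
proof -
  define a where "a k i = tensor_coord scale k (\<beta> (axis i 1))" for k i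
  interpret coaction_matrix scale \<Delta> \<epsilon> S a
    unfolding a_def by (rule coaction_matrix_coord[OF assms(1,2)])
  note vs = vector_space_axioms
  have lin: "Vector_Spaces.linear (*s) tensor_scale \<beta>" and closed: "\<beta> x \<in> tensor_space (*s) scale" for x
    using assms(2) by (auto simp: algebra_coaction_def right_comodule_def)
  have \<beta>: "\<beta> (axis i 1) = (\<Sum>k\<in>UNIV. pure_tensor (*s) scale (axis k 1) (a k i))" for i
    unfolding a_def by (rule tensor_axis_expansion[OF vs closed])
  have antipode_coeff: "S (a i j) = a j i" for i j
    using assms(3)
  proof (elim disjE)
    assume \<psi>: "comodule_hom (*s) (*) scale \<beta> (trivial_comodule scale) (\<lambda>x. \<Sum>i\<in>UNIV. x $ i)"
    have b: "bilinear_map (*s) scale tensor_scale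
        (\<lambda>x y. pure_tensor (*) scale (\<Sum>i\<in>UNIV. (x :: 'k ^ 'n) $ i) y)"
      using bilinear_pure_tensor[OF vector_space_field vs] vec.vector_space_axioms vs
      by (auto simp: bilinear_map_def Vector_Spaces.linear_iff sum.distrib simp flip: sum_distrib_left)
    \<comment> \<open>Lifting scalar multiplication identifies the tensor product of the field with
      H and H itself, so colinearity becomes an equation in H.\<close>
    have m: "bilinear_map (*) scale scale scale"
      using vector_space_field vs
      by (auto simp: bilinear_map_def Vector_Spaces.linear_iff scale_left_distrib
          scale_right_distrib mult.commute)
    have s: "(\<Sum>i\<in>UNIV. axis j (1::'k) $ i) = 1" for j :: 'n by (simp add: axis_def)
    have "pure_tensor (*) scale 1 1 = (\<Sum>k\<in>UNIV. pure_tensor (*) scale 1 (a k i))" for i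
    proof -
      have "trivial_comodule scale (\<Sum>k\<in>UNIV. axis i (1::'k) $ k) = tensor_map (*s) scale (*) scale
          (\<lambda>x. \<Sum>i\<in>UNIV. x $ i) id (\<beta> (axis i 1))"
        using \<psi> unfolding comodule_hom_def by blast
      thus ?thesis
        by (simp only: trivial_comodule_def s tensor_map_def \<beta>)
          (simp add: tensor_lift_sum[OF b] tensor_lift_pure[OF b] s)
    qed
    hence "tensor_lift (*) scale scale (pure_tensor (*) scale 1 1) =
      tensor_lift (*) scale scale (\<Sum>k\<in>UNIV. pure_tensor (*) scale 1 (a k i))" for i by simp
    hence "(\<Sum>k\<in>UNIV. scale 1 (a k i)) = scale 1 1" for i
      by (simp add: tensor_lift_sum[OF m] tensor_lift_pure[OF m])
    \<comment> \<open>Colinearity at \<open>axis i 1\<close> says that column \<open>i\<close> sums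
      to \<open>1\<close>, that is, the constant weight \<open>1\<close> is invariant.\<close>
    thus ?thesis by (rule antipode_coeff_if_weight[of "\<lambda>_. 1"]) simp
  next
    assume "S \<circ> S = id"
    hence "S (S x) = x" for x by (simp add: fun_eq_iff)
    thus ?thesis by (rule antipode_coeff_if_involutive)
  next
    assume "(CHAR('k) = 0 \<or> CHAR('k) > CARD('n)) \<and> cosemisimple scale \<Delta>"
    thus ?thesis unfolding cosemisimple_def using antipode_coeff_if_haar by blast
  qed
  let ?f = "qperm_lift scale (*) 1 a"
  interpret A: qperm_target scale UNIV "(*)" 1 a by (rule qperm_target_coeff[OF antipode_coeff])
  show ?thesis
  proof (rule ex1I[of _ ?f], intro conjI)
    show "hopf_algebra_hom qperm_scale qperm_comult qperm_counit qperm_antipode scale \<Delta> \<epsilon> S ?f"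
      by (rule hopf_algebra_hom_coeff[OF antipode_coeff])
    show "tensor_map (*s) qperm_scale (*s) scale id ?f \<circ> qperm_coaction = \<beta>"
      by (rule linear_vec_eqI[OF tensor_map_qperm_coaction_axis(2)[OF vs A.qev_linear] lin])
        (simp add: tensor_map_qperm_coaction_axis(1)[OF vs A.qev_linear] A.qev_gen \<beta>)
  next
    fix g :: "('k, 'n) qperm \<Rightarrow> 'h"
    assume g: "hopf_algebra_hom qperm_scale qperm_comult qperm_counit qperm_antipode scale \<Delta> \<epsilon> S g \<and>
      tensor_map (*s) qperm_scale (*s) scale id g \<circ> qperm_coaction = \<beta>"
    hence hom: "algebra_hom qperm_scale scale g" by (simp add: hopf_algebra_hom_def)
    hence glin: "Vector_Spaces.linear qperm_scale scale g" by (simp add: algebra_hom_def)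
    \<comment> \<open>Uniqueness of coefficients in \<open>\<beta> (axis i 1)\<close> fixes g on the
      generators, hence everywhere since g is an algebra map.\<close>
    have gen: "g (qperm_gen k i) = a k i" for k i
    proof -
      have "\<beta> (axis i 1) = (\<Sum>k\<in>UNIV. pure_tensor (*s) scale (axis k 1) (g (qperm_gen k i)))"
        using g tensor_map_qperm_coaction_axis(1)[OF vs glin, of i] by auto
      thus ?thesis by (simp add: a_def tensor_coord_sum_axis[OF vs])
    qed
    have "g x = ?f x" for x
      by (induction x rule: qperm_induct)
        (use hom in \<open>simp_all add: algebra_hom_def Vector_Spaces.linear_iff gen A.qev_add
          A.qev_scale A.qev_one A.qev_mult A.qev_gen\<close>)
    thus "g = ?f" ..
  qed
qed

end
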